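(* Let $S$ be either (i) a commutative semigroup whose universal semilattice is well-founded, or (ii) a solvable inverse semigroup whose semilattice of idempotents $E(S)$ is well-founded. Then every strongly productive ultrafilter on $S$ is idempotent.
   Context: Let $S$ be a multiplicatively written semigroup. For a sequence $\vec{x}=(x_n)_{n\in\omega}$ in $S$, $\mathrm{FP}(\vec{x})$ is the set of all products $\prod_{i\in a}x_i$ (factors taken in increasing order of indices) with $a$ ranging over the finite nonempty subsets of $\omega$; an FP-set is a set of this form. An ultrafilter $p$ on $S$ is strongly productive if for every $A\in p$ there is a sequence $\vec{x}$ with $\mathrm{FP}(\vec{x})\subseteq A$ and $\mathrm{FP}(\vec{x})\in p$. For $x\in S$ and $A\subseteq S$ put $x^{-1}A=\{y\in S: xy\in A\}$; an ultrafilter $p$ is idempotent if $p\cdot p=p$ in $\beta S$, i.e. for every $A\in p$ the set $\{x\in S: x^{-1}A\in p\}$ belongs to $p$. The universal semilattice of $S$ is the quotient $S/\mathcal{N}$ of $S$ by its smallest semilattice congruence $\mathcal{N}$ (a congruence whose quotient is commutative and idempotent). A semilattice $\Lambda$ is ordered by $x\le y$ iff $xy=x$; it is well-founded if every nonempty subset has a minimal element. An inverse semigroup is solvable in the sense of Piochi; in particular the solvable inverse semigroups of class $1$ are exactly the commutative inverse semigroups, and a solvable inverse semigroup of class $n+1$ has a congruence $\gamma$ with $S/\gamma$ commutative such that, for the quotient map $f:S\to S/\gamma$, the inverse subsemigroup $f^{-1}[E(S/\gamma)]$ is solvable of class $n$. Solvable groups are exactly the solvable inverse semigroups with one idempotent.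 *)

theory Defs
  imports Main
begin

definition ultrafilter :: "'a set set \<Rightarrow> bool" where
  "ultrafilter U \<longleftrightarrow> UNIV \<in> U \<and> {} \<notin> U
     \<and> (\<forall>A B. A \<in> U \<and> A \<subseteq> B \<longrightarrow> B \<in> U)
     \<and> (\<forall>A B. A \<in> U \<and> B \<in> U \<longrightarrow> A \<inter> B \<in> U)
     \<and> (\<forall>A. A \<in> U \<or> - A \<in> U)"

definition fprod :: "(nat \<Rightarrow> 'a::semigroup_mult) \<Rightarrow> nat set \<Rightarrow> 'a" where
  "fprod x a = (let l = map x (sorted_list_of_set a) in foldl (*) (hd l) (tl l))"

definition FP :: "(nat \<Rightarrow> 'a::semigroup_mult) \<Rightarrow> 'a set" where
  "FP x = fprod x ` {a. finite a \<and> a \<noteq> {}}"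

definition strongly_productive :: "'a::semigroup_mult set set \<Rightarrow> bool" where
  "strongly_productive p \<longleftrightarrow> ultrafilter p \<and>
     (\<forall>A \<in> p. \<exists>x. FP x \<subseteq> A \<and> FP x \<in> p)"

definition lquot :: "'a::semigroup_mult \<Rightarrow> 'a set \<Rightarrow> 'a set" where
  "lquot x A = {y. x * y \<in> A}"

definition idempotent_uf :: "'a::semigroup_mult set set \<Rightarrow> bool" where
  "idempotent_uf p \<longleftrightarrow> (\<forall>A \<in> p. {x. lquot x A \<in> p} \<in> p)"

definition congruence_on :: "'a::semigroup_mult set \<Rightarrow> ('a \<times> 'a) set \<Rightarrow> bool" where
  "congruence_on T r \<longleftrightarrow> equiv T r \<and>
     (\<forall>x y z. (x, y) \<in> r \<and> z \<in> T \<longrightarrow> (z * x, z * y) \<in> r \<and> (x * z, y * z) \<in> r)"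

definition semilattice_congruence :: "('a::semigroup_mult \<times> 'a) set \<Rightarrow> bool" where
  "semilattice_congruence r \<longleftrightarrow> congruence_on UNIV r \<and>
     (\<forall>x y. (x * y, y * x) \<in> r) \<and> (\<forall>x. (x * x, x) \<in> r)"

definition univ_sl_cong :: "('a::semigroup_mult \<times> 'a) set" where
  "univ_sl_cong = \<Inter> {r. semilattice_congruence r}"

text \<open>Well-foundedness of the universal semilattice S/N with order [x] \<le> [y] iff [x][y] = [x].\<close>
definition univ_semilattice_wf :: "'a::semigroup_mult itself \<Rightarrow> bool" where
  "univ_semilattice_wf TYPE('a) \<longleftrightarrow>
     (\<forall>X \<subseteq> (UNIV :: 'a set) // univ_sl_cong. X \<noteq> {} \<longrightarrow>
        (\<exists>M \<in> X. \<forall>C \<in> X. (\<exists>x \<in> C. \<exists>y \<in> M. (x * y, x) \<in> univ_sl_cong) \<longrightarrow> C = M))"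

definition inverse_semigroup_on :: "'a::semigroup_mult set \<Rightarrow> bool" where
  "inverse_semigroup_on T \<longleftrightarrow> (\<forall>x \<in> T. \<forall>y \<in> T. x * y \<in> T) \<and>
     (\<forall>x \<in> T. \<exists>!y. y \<in> T \<and> x * y * x = x \<and> y * x * y = y)"

text \<open>Solvable inverse semigroups of class n (Piochi); the quotient T/gamma is represented
  via gamma, and the preimage of its idempotents is {x in T. (x*x, x) in gamma}.\<close>
fun solvable_class :: "nat \<Rightarrow> 'a::semigroup_mult set \<Rightarrow> bool" where
  "solvable_class 0 T = False"
| "solvable_class (Suc 0) T \<longleftrightarrow> inverse_semigroup_on T \<and> (\<forall>x \<in> T. \<forall>y \<in> T. x * y = y * x)"
| "solvable_class (Suc (Suc n)) T \<longleftrightarrow> inverse_semigroup_on T \<and>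
     (\<exists>\<gamma>. congruence_on T \<gamma> \<and> (\<forall>x \<in> T. \<forall>y \<in> T. (x * y, y * x) \<in> \<gamma>) \<and>
          solvable_class (Suc n) {x \<in> T. (x * x, x) \<in> \<gamma>})"

definition solvable_inverse :: "'a::semigroup_mult set \<Rightarrow> bool" where
  "solvable_inverse T \<longleftrightarrow> (\<exists>n. solvable_class n T)"

definition idempotents_wf :: "'a::semigroup_mult itself \<Rightarrow> bool" where
  "idempotents_wf TYPE('a) \<longleftrightarrow>
     (\<forall>A \<subseteq> {e :: 'a. e * e = e}. A \<noteq> {} \<longrightarrow> (\<exists>m \<in> A. \<forall>a \<in> A. a * m = a \<longrightarrow> a = m))"

end

theory Submission
  imports Defs Complex_Main "HOL-Library.Countable_Set"
begin

text \<open>A strongly productive ultrafilter \<open>p\<close> is idempotent once, for suitable FP-sets in \<open>p\<close>, the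
  products whose smallest index is \<open>i\<close> form a set outside \<open>p\<close>, for every \<open>i\<close>. Assume \<open>p\<close> is not
  idempotent. If \<open>p\<close> lives on a subsemigroup \<open>U\<close>, this criterion, applied to sets cut out by
  homomorphisms from \<open>U\<close> to the circle, forces the common kernel \<open>K\<close> of all these homomorphisms into \<open>p\<close>.
  As characters separate points of abelian groups, \<open>K\<close> is just the kernel of the map from \<open>U\<close> to the
  group completion of any commutative quotient of \<open>U\<close>. Applied to principal ideals of a semilattice,
  the same criterion together with well-foundedness shows that \<open>p\<close> lives on a single class \<open>U\<close>:
  an archimedean component in case (i), in which \<open>K\<close> is a nilsemigroup and contains no
  suitable FP-set; the preimage of a maximal subgroup of the commutative quotient \<open>S/\<gamma>\<close> in case
  (ii), in which \<open>K\<close> lies over an idempotent, so that induction on the solvability class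
  applies.\<close>

section \<open>Finite products\<close>

lemma foldl_mult_assoc:
  fixes a b :: "'a::semigroup_mult"
  shows "foldl (*) (a * b) l = a * foldl (*) b l"
  by (induction l arbitrary: b) (simp_all add: mult.assoc)

lemma fprod_singleton [simp]: "fprod x {i} = x i"
  by (simp add: fprod_def)

lemma fprod_Un:
  assumes a: "finite a" "a \<noteq> {}" and b: "finite b" "b \<noteq> {}"
    and less: "\<And>i j. i \<in> a \<Longrightarrow> j \<in> b \<Longrightarrow> i < j"
  shows "fprod x (a \<union> b) = fprod x a * fprod x b"
proof -
  have disj: "a \<inter> b = {}" using less by fastforce
  have split: "sorted_list_of_set (a \<union> b) = sorted_list_of_set a @ sorted_list_of_set b"
  proof (rule sorted_distinct_set_unique)
    show "sorted (sorted_list_of_set a @ sorted_list_of_set b)"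
      using a b less by (auto simp: sorted_append intro: less_imp_le)
  qed (use a b disj in auto)
  \<comment> \<open>No unit is available, so \<open>fprod\<close> folds from the head of its list;
    both lists must be exposed as nonempty.\<close>
  obtain h t where t: "sorted_list_of_set a = h # t"
    using a by (cases "sorted_list_of_set a") auto
  obtain k u where u: "sorted_list_of_set b = k # u"
    using b by (cases "sorted_list_of_set b") auto
  show ?thesis
    unfolding fprod_def Let_def split t u by (simp add: foldl_mult_assoc)
qed

definition FP_from :: "(nat \<Rightarrow> 'a::semigroup_mult) \<Rightarrow> nat \<Rightarrow> 'a set" where
  "FP_from x n = fprod x ` {a. finite a \<and> a \<noteq> {} \<and> a \<subseteq> {n..}}"

definition FP_min :: "(nat \<Rightarrow> 'a::semigroup_mult) \<Rightarrow> nat \<Rightarrow> 'a set" where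
  "FP_min x i = fprod x ` {a. finite a \<and> i \<in> a \<and> a \<subseteq> {i..}}"

lemma fprod_in_FP: "finite a \<Longrightarrow> a \<noteq> {} \<Longrightarrow> fprod x a \<in> FP x"
  by (auto simp: FP_def)

lemma term_in_FP: "x i \<in> FP x"
  using fprod_in_FP[of "{i}" x] by simp

lemma mult_in_FP: "i < j \<Longrightarrow> x i * x j \<in> FP x"
  using fprod_in_FP[of "{i} \<union> {j}" x] fprod_Un[of "{i}" "{j}" x] by simp

lemma FP_min_cases:
  assumes "z \<in> FP_min x i"
  obtains "z = x i" | b where "b \<in> FP x" "z = x i * b"
proof -
  obtain a where a: "finite a" "i \<in> a" "a \<subseteq> {i..}" "z = fprod x a"
    using assms by (auto simp: FP_min_def)
  show ?thesis
  proof (cases "a - {i} = {}")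
    case True
    then have "a = {i}" using a by auto
    then show ?thesis using a that by simp
  next
    case False
    have "a = {i} \<union> (a - {i})" using a by auto
    moreover have "fprod x ({i} \<union> (a - {i})) = fprod x {i} * fprod x (a - {i})"
      by (rule fprod_Un) (use a False in force)+
    ultimately have "z = x i * fprod x (a - {i})" using a by simp
    then show ?thesis using that(2) fprod_in_FP[of "a - {i}" x] a False by auto
  qed
qed

lemma FP_subset_from_min: "FP x \<subseteq> FP_from x n \<union> (\<Union>i<n. FP_min x i)"
proof
  fix z assume "z \<in> FP x"
  then obtain a where a: "finite a" "a \<noteq> {}" "z = fprod x a" by (auto simp: FP_def)
  show "z \<in> FP_from x n \<union> (\<Union>i<n. FP_min x i)"
  proof (cases "Min a < n")
    case True
    have "Min a \<in> a \<and> a \<subseteq> {Min a..}" using a by auto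
    then have "z \<in> FP_min x (Min a)" using a unfolding FP_min_def by blast
    then show ?thesis using True by blast
  next
    case False
    then have "a \<subseteq> {n..}" using Min_le[OF a(1)] by fastforce
    then show ?thesis using a by (auto simp: FP_from_def)
  qed
qed

section \<open>Strongly productive ultrafilters\<close>

lemma uf_mono: "ultrafilter p \<Longrightarrow> A \<in> p \<Longrightarrow> A \<subseteq> B \<Longrightarrow> B \<in> p"
  unfolding ultrafilter_def by blast

lemma uf_Int: "ultrafilter p \<Longrightarrow> A \<in> p \<Longrightarrow> B \<in> p \<Longrightarrow> A \<inter> B \<in> p"
  unfolding ultrafilter_def by blast

lemma uf_Diff:
  assumes "ultrafilter p" "A \<in> p" "B \<notin> p"
  shows "A - B \<in> p"
proof -
  have "- B \<in> p" using assms unfolding ultrafilter_def by blast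
  then show ?thesis using uf_Int[OF assms(1,2)] by (simp add: Diff_eq)
qed

lemma uf_nonempty: "ultrafilter p \<Longrightarrow> A \<in> p \<Longrightarrow> A \<noteq> {}"
  unfolding ultrafilter_def by blast

lemma uf_Un:
  assumes "ultrafilter p" "A \<notin> p" "B \<notin> p"
  shows "A \<union> B \<notin> p"
proof
  assume "A \<union> B \<in> p"
  then have "(A \<union> B) - A - B \<in> p" using assms by (intro uf_Diff)
  then show False using uf_nonempty[OF assms(1)] by blast
qed

lemma uf_UN:
  assumes "ultrafilter p" "finite I" "\<And>i. i \<in> I \<Longrightarrow> A i \<notin> p"
  shows "(\<Union>i\<in>I. A i) \<notin> p"
  using assms(2,3)
proof (induction I rule: finite_induct)
  case empty
  then show ?case using uf_nonempty[OF assms(1)] by auto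
next
  case (insert i I)
  then show ?case using uf_Un[OF assms(1)] by auto
qed

lemma sp_uf: "strongly_productive p \<Longrightarrow> ultrafilter p"
  by (simp add: strongly_productive_def)

lemma sp_FP:
  assumes "strongly_productive p" "A \<in> p"
  obtains x where "FP x \<subseteq> A" "FP x \<in> p"
  using assms unfolding strongly_productive_def by blast

text \<open>An FP-set inside \<open>A\<close> would contain \<open>x 0\<close>, \<open>x 1\<close>
  and their product \<open>x 0 * x 1\<close>.\<close>

lemma sp_sum_free:
  assumes "strongly_productive p" "\<And>y z. y \<in> A \<Longrightarrow> z \<in> A \<Longrightarrow> y * z \<notin> A"
  shows "A \<notin> p"
proof
  assume "A \<in> p"
  then obtain x where "FP x \<subseteq> A" using sp_FP assms(1) by blast
  then show False
    using assms(2)[of "x 0" "x 1"] term_in_FP[of x 0] term_in_FP[of x 1] mult_in_FP[of 0 1 x] by auto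
qed

text \<open>This settles the principal case: \<open>e\<close> is an idempotent, since otherwise
  \<open>{e}\<close> would be product-free.\<close>

lemma sp_singleton:
  assumes sp: "strongly_productive p" and e: "{e} \<in> p"
  shows "idempotent_uf p"
  unfolding idempotent_uf_def
proof
  fix A assume "A \<in> p"
  then have "e \<in> A" using uf_Int[OF sp_uf[OF sp] e] uf_nonempty[OF sp_uf[OF sp]] by blast
  moreover have "e * e = e" using sp_sum_free[OF sp, of "{e}"] e by auto
  ultimately have "{e} \<subseteq> lquot e A" by (simp add: lquot_def)
  then have "{e} \<subseteq> {x. lquot x A \<in> p}" using uf_mono[OF sp_uf[OF sp] e] by simp
  then show "{x. lquot x A \<in> p} \<in> p" using uf_mono[OF sp_uf[OF sp] e] by simp
qed

text \<open>If every tail \<open>FP_from x n\<close> of an FP-set in \<open>p\<close> is again in \<open>p\<close>, then \<open>FP x\<close> itself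
  consists of elements \<open>z\<close> with \<open>lquot z (FP x) \<in> p\<close>.\<close>
lemma idempotent_criterion:
  assumes sp: "strongly_productive p" and B: "B \<in> p"
    and min: "\<And>x i. FP x \<subseteq> B \<Longrightarrow> FP_min x i \<notin> p"
  shows "idempotent_uf p"
  unfolding idempotent_uf_def
proof
  note uf = sp_uf[OF sp]
  fix A assume A: "A \<in> p"
  obtain x where x: "FP x \<subseteq> A \<inter> B" "FP x \<in> p"
    using sp_FP[OF sp uf_Int[OF uf A B]] by blast
  have tail: "FP_from x n \<in> p" for n
  proof (rule ccontr)
    assume "FP_from x n \<notin> p"
    moreover have "(\<Union>i<n. FP_min x i) \<notin> p"
      by (rule uf_UN[OF uf]) (use min x(1) in auto)
    ultimately show False
      using uf_Un[OF uf] uf_mono[OF uf x(2) FP_subset_from_min] by blast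
  qed
  have "FP x \<subseteq> {z. lquot z A \<in> p}"
  proof
    fix z assume "z \<in> FP x"
    then obtain a where a: "finite a" "a \<noteq> {}" "z = fprod x a" by (auto simp: FP_def)
    have "FP_from x (Suc (Max a)) \<subseteq> lquot z A"
    proof
      fix w assume "w \<in> FP_from x (Suc (Max a))"
      then obtain b where b: "finite b" "b \<noteq> {}" "b \<subseteq> {Suc (Max a)..}" "w = fprod x b"
        by (auto simp: FP_from_def)
      have "i < j" if "i \<in> a" "j \<in> b" for i j
      proof -
      have "i \<le> Max a" "Suc (Max a) \<le> j" using that a b by auto
      then show ?thesis by linarith
    qed
      then have "fprod x (a \<union> b) = z * w" using fprod_Un[of a b x] a b by simp
      then have "z * w \<in> FP x" using fprod_in_FP[of "a \<union> b" x] a b by simp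
      then show "w \<in> lquot z A" using x by (auto simp: lquot_def)
    qed
    then show "z \<in> {z. lquot z A \<in> p}" using uf_mono[OF uf tail] by simp
  qed
  then show "{z. lquot z A \<in> p} \<in> p" by (rule uf_mono[OF uf x(2)])
qed

text \<open>The criterion is applied to the elements whose \<open>D x\<close> is outside
  \<open>p\<close>: products with smallest index \<open>i\<close> stay in \<open>D (x i)\<close>. In
  both uses \<open>D x\<close> is the preimage of the principal ideal that \<open>x\<close>
  generates in a commutative quotient.\<close>

lemma sp_ideal_dichotomy:
  assumes sp: "strongly_productive p" and T: "T \<in> p" and nid: "\<not> idempotent_uf p"
    and D: "\<And>x. x \<in> T \<Longrightarrow> x \<in> D x" "\<And>x y. x \<in> T \<Longrightarrow> y \<in> T \<Longrightarrow> x * y \<in> D x"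
  shows "{x \<in> T. D x \<in> p} \<in> p"
proof (rule ccontr)
  note uf = sp_uf[OF sp]
  assume "{x \<in> T. D x \<in> p} \<notin> p"
  then have B: "T - {x \<in> T. D x \<in> p} \<in> p" by (rule uf_Diff[OF uf T])
  have "FP_min x i \<notin> p" if x: "FP x \<subseteq> T - {x \<in> T. D x \<in> p}" for x i
  proof -
    have "FP_min x i \<subseteq> D (x i)"
      using x term_in_FP[of x i] D by (blast elim: FP_min_cases)
    moreover have "D (x i) \<notin> p" using x term_in_FP[of x i] by blast
    ultimately show ?thesis using uf_mono[OF uf] by blast
  qed
  from idempotent_criterion[OF sp B this] nid show False by blast
qed

section \<open>Characters\<close>

text \<open>Homomorphisms into the circle group are represented by real-valued functions that are
  additive modulo \<open>\<int>\<close>.\<close>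
definition character_on :: "'a::semigroup_mult set \<Rightarrow> ('a \<Rightarrow> real) \<Rightarrow> bool" where
  "character_on U \<phi> \<longleftrightarrow> (\<forall>x\<in>U. \<forall>y\<in>U. \<phi> (x * y) - (\<phi> x + \<phi> y) \<in> \<int>)"

definition character_kernel :: "'a::semigroup_mult set \<Rightarrow> 'a set" where
  "character_kernel U = {x \<in> U. \<forall>\<phi>. character_on U \<phi> \<longrightarrow> \<phi> x \<in> \<int>}"

section \<open>Arithmetic modulo the integers\<close>

lemma Ints_diff_cong:
  fixes a b :: real
  assumes "a - b \<in> \<int>"
  shows "a \<in> \<int> \<longleftrightarrow> b \<in> \<int>"
proof -
  have "a = (a - b) + b" "b = a - (a - b)" by simp_all
  then show ?thesis using assms Ints_add Ints_diff by metis
qed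

lemma diff_frac_in_Ints: "a - frac a \<in> \<int>"
  by (simp add: frac_def)

lemma frac_eqI: "a - c \<in> \<int> \<Longrightarrow> 0 \<le> c \<Longrightarrow> c < 1 \<Longrightarrow> frac a = c" for a c :: real
  by (simp add: frac_unique_iff)

lemma twice_in_Ints_iff:
  fixes a :: real
  shows "2 * a \<in> \<int> \<longleftrightarrow> a \<in> \<int> \<or> frac a = 1 / 2"
proof
  assume "2 * a \<in> \<int>"
  moreover have "2 * a - 2 * frac a \<in> \<int>"
    using Ints_mult[OF Ints_numeral diff_frac_in_Ints, of "num.Bit0 num.One" a]
    by (simp add: right_diff_distrib)
  ultimately have "2 * frac a \<in> \<int>" using Ints_diff_cong by blast
  then obtain k :: int where k: "2 * frac a = of_int k" by (auto elim: Ints_cases)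
  have "0 \<le> frac a" "frac a < 1" by (simp_all add: frac_lt_1)
  then have "0 \<le> k" "k < 2" using k by linarith+
  then have "k = 0 \<or> k = 1" by auto
  then show "a \<in> \<int> \<or> frac a = 1 / 2" using k by (auto simp: frac_eq_0_iff)
next
  assume "a \<in> \<int> \<or> frac a = 1 / 2"
  then show "2 * a \<in> \<int>"
  proof
    assume "frac a = 1 / 2"
    then have "2 * a = of_int (2 * \<lfloor>a\<rfloor> + 1)" by (simp add: frac_def)
    then show ?thesis by (metis Ints_of_int)
  qed (simp add: Ints_mult)
qed

lemma twice_notin_Ints: "0 < frac a \<Longrightarrow> frac a < 1 / 2 \<Longrightarrow> 2 * a \<notin> \<int>" for a :: real
  using frac_eq_0_iff[of a] by (auto simp: twice_in_Ints_iff)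

text \<open>Inverting a character exchanges the two open half circles, so only the arc between 0 and
  1/2 has to be treated; the excluded values 0 and 1/2 are the points of order at most two.\<close>

lemma frac_or_frac_minus:
  fixes a :: real
  assumes "2 * a \<notin> \<int>"
  shows "0 < frac a \<and> frac a < 1 / 2 \<or> 0 < frac (- a) \<and> frac (- a) < 1 / 2"
proof -
  have "a \<notin> \<int>" "frac a \<noteq> 1 / 2" using assms by (auto simp: twice_in_Ints_iff)
  then show ?thesis using frac_neg[of a] frac_ge_0[of a] frac_eq_0_iff[of a] frac_lt_1[of a] by auto
qed

lemma sum_diff_in_Ints:
  "(\<And>j. j \<in> F \<Longrightarrow> f j - g j \<in> \<int>) \<Longrightarrow> sum f F - sum g F \<in> (\<int> :: real set)"
  by (simp add: sum_subtractf[symmetric] Ints_sum)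

text \<open>Common indices are counted twice and contribute integers. Hence, for values of order
  two, adding sums amounts to taking symmetric differences of index sets.\<close>

lemma sum_sym_diff_in_Ints:
  fixes h :: "'b \<Rightarrow> real"
  assumes "finite A" "finite B" and h: "\<And>j. 2 * h j \<in> \<int>"
  shows "sum h A + sum h B - sum h (sym_diff A B) \<in> \<int>"
proof -
  have "sum h A = sum h (A - B) + sum h (A \<inter> B)" "sum h B = sum h (B - A) + sum h (A \<inter> B)"
    using sum.Int_Diff[OF assms(1), of h B] sum.Int_Diff[OF assms(2), of h A] by (simp_all add: Int_commute)
  moreover have "sum h (sym_diff A B) = sum h (A - B) + sum h (B - A)"
    using assms(1,2) by (intro sum.union_disjoint) auto
  ultimately have "sum h A + sum h B - sum h (sym_diff A B) = (\<Sum>j\<in>A \<inter> B. 2 * h j)"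
    by (simp add: sum_distrib_left[symmetric])
  then show ?thesis using h by (simp add: Ints_sum)
qed

lemma character_uminus: "character_on U \<phi> \<Longrightarrow> character_on U (\<lambda>x. - \<phi> x)"
  unfolding character_on_def
proof (intro ballI)
  fix x y assume "\<forall>x\<in>U. \<forall>y\<in>U. \<phi> (x * y) - (\<phi> x + \<phi> y) \<in> \<int>" "x \<in> U" "y \<in> U"
  then have "- (\<phi> (x * y) - (\<phi> x + \<phi> y)) \<in> \<int>" by (intro Ints_minus) auto
  then show "- \<phi> (x * y) - (- \<phi> x + - \<phi> y) \<in> \<int>" by (simp add: algebra_simps)
qed

section \<open>Characters along a strongly productive ultrafilter assumed not idempotent\<close>

locale productive_subsemigroup =
  fixes p :: "'a::semigroup_mult set set" and U :: "'a set"
  assumes sp: "strongly_productive p" and U: "U \<in> p"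
    and closed: "\<And>x y. x \<in> U \<Longrightarrow> y \<in> U \<Longrightarrow> x * y \<in> U"
    and not_idempotent: "\<not> idempotent_uf p"
begin

lemmas uf = sp_uf[OF sp]

lemma criterion: "(\<And>x i. FP x \<subseteq> B \<Longrightarrow> FP_min x i \<notin> p) \<Longrightarrow> B \<notin> p"
  using idempotent_criterion[OF sp] not_idempotent by blast

lemma character_mult:
  "character_on U \<phi> \<Longrightarrow> x \<in> U \<Longrightarrow> y \<in> U \<Longrightarrow> \<phi> (x * y) - (\<phi> x + \<phi> y) \<in> \<int>"
  by (simp add: character_on_def)

text \<open>No carry modulo 1 occurs as long as the fractional parts add up to less than 1.\<close>

lemma frac_character_mult:
  assumes "character_on U \<phi>" "x \<in> U" "y \<in> U" "frac (\<phi> x) + frac (\<phi> y) < 1"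
  shows "frac (\<phi> (x * y)) = frac (\<phi> x) + frac (\<phi> y)"
proof (rule frac_eqI)
  have "(\<phi> (x * y) - (\<phi> x + \<phi> y)) + (\<phi> x - frac (\<phi> x)) + (\<phi> y - frac (\<phi> y)) \<in> \<int>"
    using character_mult[OF assms(1-3)] by (intro Ints_add diff_frac_in_Ints)
  then show "\<phi> (x * y) - (frac (\<phi> x) + frac (\<phi> y)) \<in> \<int>" by (simp add: algebra_simps)
qed (use assms in auto)

text \<open>Membership in \<open>U\<close> is carried through the induction because
  \<open>\<phi>\<close> is additive only there; the largest index is split off because
  \<open>fprod\<close> multiplies in increasing order.\<close>

lemma fprod_closed_character:
  assumes x: "\<And>j. x j \<in> U" and ch: "character_on U \<phi>" and F: "finite F" "F \<noteq> {}"
  shows "fprod x F \<in> U \<and> \<phi> (fprod x F) - (\<Sum>j\<in>F. \<phi> (x j)) \<in> \<int>"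
  using F
proof (induction F rule: finite_linorder_max_induct)
  case (insert b A)
  show ?case
  proof (cases "A = {}")
    case False
    have eq: "fprod x (insert b A) = fprod x A * x b"
      using fprod_Un[of A "{b}" x] insert.hyps False by simp
    have IH: "fprod x A \<in> U" "\<phi> (fprod x A) - (\<Sum>j\<in>A. \<phi> (x j)) \<in> \<int>"
      using insert.IH False by auto
    have "b \<notin> A" using insert.hyps by auto
    have "(\<phi> (fprod x A * x b) - (\<phi> (fprod x A) + \<phi> (x b))) + (\<phi> (fprod x A) - (\<Sum>j\<in>A. \<phi> (x j))) \<in> \<int>"
      by (intro Ints_add IH character_mult[OF ch] x)
    then show ?thesis
      using IH closed x \<open>b \<notin> A\<close> insert.hyps by (simp add: eq algebra_simps)
  qed (use x in simp)
qed simp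

lemmas character_fprod = conjunct2[OF fprod_closed_character]

text \<open>Doubling leaves each of the shells \<open>2\<^sup>-\<^sup>k\<^sup>-\<^sup>1 \<le> frac \<circ> \<phi> < 2\<^sup>-\<^sup>k\<close>, so \<open>frac \<circ> \<phi>\<close> would
  have to tend to 0 along \<open>p\<close>; but it is at least \<open>frac (\<phi> (x i))\<close> on \<open>FP_min x i\<close>.\<close>
lemma positive_arc_notin:
  assumes ch: "character_on U \<phi>"
  shows "{x \<in> U. 0 < frac (\<phi> x) \<and> frac (\<phi> x) < 1 / 2} \<notin> p"
proof (rule criterion)
  fix x :: "nat \<Rightarrow> 'a" and i
  let ?S = "\<lambda>k. {z \<in> U. 1 / 2 ^ Suc k \<le> frac (\<phi> z) \<and> frac (\<phi> z) < 1 / 2 ^ k}"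
  \<comment> \<open>Starting at \<open>Suc k\<close> keeps all values below 1/2, so there is no
    carry: a product has at least twice the lower end of the shell, which is its excluded upper
    end.\<close>
  have shell: "?S (Suc k) \<notin> p" for k
  proof (rule sp_sum_free[OF sp])
    fix y z assume yz: "y \<in> ?S (Suc k)" "z \<in> ?S (Suc k)"
    have "(1::real) / 2 ^ Suc k \<le> 1 / 2" by (simp add: field_simps)
    moreover have "frac (\<phi> y) < 1 / 2 ^ Suc k" "frac (\<phi> z) < 1 / 2 ^ Suc k" using yz by blast+
    ultimately have "frac (\<phi> y) + frac (\<phi> z) < 1" by linarith
    then have "frac (\<phi> (y * z)) = frac (\<phi> y) + frac (\<phi> z)"
      using frac_character_mult[OF ch] yz by blast
    then show "y * z \<notin> ?S (Suc k)" using yz by (auto simp: field_simps)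
  qed
  \<comment> \<open>The part of the arc bounded away from 0 is covered by finitely many
    shells.\<close>
  have far: "{z \<in> U. 1 / 2 ^ Suc k \<le> frac (\<phi> z) \<and> frac (\<phi> z) < 1 / 2} \<notin> p" for k
  proof (induction k)
    case 0
    have "{z \<in> U. 1 / 2 ^ Suc 0 \<le> frac (\<phi> z) \<and> frac (\<phi> z) < 1 / 2} = {}" by auto
    then show ?case using uf_nonempty[OF uf] by metis
  next
    case (Suc k)
    have "{z \<in> U. 1 / 2 ^ Suc (Suc k) \<le> frac (\<phi> z) \<and> frac (\<phi> z) < 1 / 2} \<subseteq>
       {z \<in> U. 1 / 2 ^ Suc k \<le> frac (\<phi> z) \<and> frac (\<phi> z) < 1 / 2} \<union> ?S (Suc k)" by auto
    then show ?case using uf_Un[OF uf Suc shell] uf_mono[OF uf] by blast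
  qed
  assume x: "FP x \<subseteq> {x \<in> U. 0 < frac (\<phi> x) \<and> frac (\<phi> x) < 1 / 2}"
  then have "0 < frac (\<phi> (x i))" using term_in_FP[of x i] by auto
  then obtain k where k: "(1 / 2) ^ k < frac (\<phi> (x i))"
    using real_arch_pow_inv[of "frac (\<phi> (x i))" "1 / 2"] by auto
  have k': "1 / 2 ^ Suc k \<le> frac (\<phi> (x i))"
  proof -
    have "1 / 2 ^ Suc k \<le> (1 / 2 :: real) ^ k" by (simp add: field_simps)
    then show ?thesis using k by linarith
  qed
  have "FP_min x i \<subseteq> {z \<in> U. 1 / 2 ^ Suc k \<le> frac (\<phi> z) \<and> frac (\<phi> z) < 1 / 2}"
  proof
    fix z assume z: "z \<in> FP_min x i"
    then have "z \<in> FP x" by (auto simp: FP_min_def FP_def)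
    then have zB: "z \<in> U" "frac (\<phi> z) < 1 / 2" using x by auto
    from z have "frac (\<phi> (x i)) \<le> frac (\<phi> z)"
    proof (cases rule: FP_min_cases)
      case (2 b)
      have "x i \<in> U" "b \<in> U" "frac (\<phi> (x i)) < 1 / 2" "frac (\<phi> b) < 1 / 2"
        using x 2 term_in_FP[of x i] by auto
      then show ?thesis using frac_character_mult[OF ch, of "x i" b] 2 by simp
    qed simp
    then show "z \<in> {z \<in> U. 1 / 2 ^ Suc k \<le> frac (\<phi> z) \<and> frac (\<phi> z) < 1 / 2}"
      using zB k' by simp
  qed
  then show "FP_min x i \<notin> p" using far uf_mono[OF uf] by blast
qed

text \<open>Outside the kernel, the value is 1/2 or it lies in one of the two open half circles. The
  half circles are excluded by \<open>positive_arc_notin\<close> for \<phi> and its inverse, the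
  value 1/2 because 1/2 + 1/2 = 1 makes its preimage product-free.\<close>

lemma character_kernel_in:
  assumes ch: "character_on U \<phi>"
  shows "{x \<in> U. \<phi> x \<in> \<int>} \<in> p"
proof (rule ccontr)
  assume "{x \<in> U. \<phi> x \<in> \<int>} \<notin> p"
  then have N: "U - {x \<in> U. \<phi> x \<in> \<int>} \<in> p" by (rule uf_Diff[OF uf U])
  have half: "{x \<in> U. frac (\<phi> x) = 1 / 2} \<notin> p"
  proof (rule sp_sum_free[OF sp])
    fix y z assume yz: "y \<in> {x \<in> U. frac (\<phi> x) = 1 / 2}" "z \<in> {x \<in> U. frac (\<phi> x) = 1 / 2}"
    have "(\<phi> (y * z) - (\<phi> y + \<phi> z)) + (\<phi> y - frac (\<phi> y)) + (\<phi> z - frac (\<phi> z)) + 1 \<in> \<int>"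
      by (intro Ints_add diff_frac_in_Ints character_mult[OF ch] Ints_1) (use yz in auto)
    moreover have "frac (\<phi> y) = 1 / 2" "frac (\<phi> z) = 1 / 2" using yz by blast+
    then have "(\<phi> (y * z) - (\<phi> y + \<phi> z)) + (\<phi> y - frac (\<phi> y)) + (\<phi> z - frac (\<phi> z)) + 1 = \<phi> (y * z)"
      by linarith
    ultimately have "\<phi> (y * z) \<in> \<int>" by metis
    then have "frac (\<phi> (y * z)) \<noteq> 1 / 2" using frac_eq_0_iff[of "\<phi> (y * z)"] by linarith
    then show "y * z \<notin> {x \<in> U. frac (\<phi> x) = 1 / 2}" by blast
  qed
  have "U - {x \<in> U. \<phi> x \<in> \<int>} \<subseteq> {x \<in> U. frac (\<phi> x) = 1 / 2} \<union>
     ({x \<in> U. 0 < frac (\<phi> x) \<and> frac (\<phi> x) < 1 / 2} \<union>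
      {x \<in> U. 0 < frac (- \<phi> x) \<and> frac (- \<phi> x) < 1 / 2})"
    using frac_or_frac_minus twice_in_Ints_iff by blast
  moreover have "\<dots> \<notin> p"
    by (intro uf_Un[OF uf] half positive_arc_notin ch character_uminus)
  ultimately show False using uf_mono[OF uf N] by blast
qed

text \<open>Let the level of \<open>z\<close> be the first \<open>n\<close> with \<open>2 \<phi>\<^sub>n(z) \<noteq> 0\<close>. In an FP-set inside this set, \<open>\<phi>\<^sub>m\<close> vanishes on
  the terms of level above \<open>m\<close> (otherwise it would be \<open>1/2\<close> there, and adding such a term to one of
  level \<open>m\<close> would leave the arc), while the values on terms of level \<open>m\<close>
  never add up beyond \<open>1/2\<close>. So a product containing \<open>x i\<close> lies outside the kernel of some \<open>\<phi>\<^sub>m\<close> with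
  \<open>m\<close> at most the level of \<open>x i\<close>.\<close>
lemma positive_level_notin:
  fixes \<phi> :: "nat \<Rightarrow> 'a \<Rightarrow> real"
  assumes ch: "\<And>n. character_on U (\<phi> n)"
  shows "{x \<in> U. \<exists>n. (\<forall>m<n. 2 * \<phi> m x \<in> \<int>) \<and> 0 < frac (\<phi> n x) \<and> frac (\<phi> n x) < 1 / 2} \<notin> p"
    (is "?B \<notin> p")
proof (rule criterion)
  fix x :: "nat \<Rightarrow> 'a" and i
  assume x: "FP x \<subseteq> ?B"
  define lev where "lev z = (LEAST n. 2 * \<phi> n z \<notin> \<int>)" for z
  have lev_eq: "lev z = n" if "\<forall>m<n. 2 * \<phi> m z \<in> \<int>" "2 * \<phi> n z \<notin> \<int>" for z n
    unfolding lev_def by (rule Least_equality) (use that not_le_imp_less in blast)+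
  have levB: "z \<in> U \<and> (\<forall>m<lev z. 2 * \<phi> m z \<in> \<int>) \<and> 0 < frac (\<phi> (lev z) z) \<and> frac (\<phi> (lev z) z) < 1 / 2"
    if z: "z \<in> FP x" for z
  proof -
    obtain n where n: "z \<in> U" "\<forall>m<n. 2 * \<phi> m z \<in> \<int>" "0 < frac (\<phi> n z)" "frac (\<phi> n z) < 1 / 2"
      using z x by blast
    then have "lev z = n" by (intro lev_eq twice_notin_Ints)
    then show ?thesis using n by simp
  qed
  have levx: "x j \<in> U" "m < lev (x j) \<Longrightarrow> 2 * \<phi> m (x j) \<in> \<int>" "0 < frac (\<phi> (lev (x j)) (x j))"
    "frac (\<phi> (lev (x j)) (x j)) < 1 / 2" for j m
    using levB[OF term_in_FP[of x j]] by auto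
  have twice_sum: "2 * a \<in> \<int> \<longleftrightarrow> 2 * b \<in> \<int>" if "a - b \<in> \<int>" for a b :: real
  proof (rule Ints_diff_cong)
    show "2 * a - 2 * b \<in> \<int>" using Ints_mult[OF Ints_numeral that, of "num.Bit0 num.One"]
      by (simp add: right_diff_distrib)
  qed
  have higher: "\<phi> (lev (x j)) (x k) \<in> \<int>" if less: "lev (x j) < lev (x k)" for j k
  proof (rule ccontr)
    define m where "m = lev (x j)"
    assume "\<phi> (lev (x j)) (x k) \<notin> \<int>"
    then have half: "frac (\<phi> m (x k)) = 1 / 2"
      using levx(2)[OF less] by (simp add: twice_in_Ints_iff m_def)
    have "j \<noteq> k" using less by auto
    define z where "z = (if j < k then x j * x k else x k * x j)"
    have zFP: "z \<in> FP x" using \<open>j \<noteq> k\<close> mult_in_FP[of j k x] mult_in_FP[of k j x] by (auto simp: z_def)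
    have z: "\<phi> l z - (\<phi> l (x j) + \<phi> l (x k)) \<in> \<int>" for l
      using character_mult[OF ch levx(1) levx(1), of l j k] character_mult[OF ch levx(1) levx(1), of l k j]
      by (simp add: z_def add.commute)
    have fr: "frac (\<phi> m z) = frac (\<phi> m (x j)) + 1 / 2"
    proof (rule frac_eqI)
      have "(\<phi> m z - (\<phi> m (x j) + \<phi> m (x k))) + (\<phi> m (x j) - frac (\<phi> m (x j)))
         + (\<phi> m (x k) - frac (\<phi> m (x k))) \<in> \<int>"
        by (intro Ints_add z diff_frac_in_Ints)
      then show "\<phi> m z - (frac (\<phi> m (x j)) + 1 / 2) \<in> \<int>" by (simp add: half algebra_simps)
    qed (use levx(3,4)[of j] in \<open>auto simp: m_def\<close>)
    have "lev z = m"
    proof (rule lev_eq)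
      show "\<forall>l<m. 2 * \<phi> l z \<in> \<int>"
      proof (intro allI impI)
        fix l assume "l < m"
        then have "2 * \<phi> l (x j) + 2 * \<phi> l (x k) \<in> \<int>"
          using less by (intro Ints_add levx(2)) (auto simp: m_def)
        then show "2 * \<phi> l z \<in> \<int>" using twice_sum[OF z[of l]] by (simp add: distrib_left)
      qed
      have "frac (\<phi> m z) \<noteq> 0" "frac (\<phi> m z) \<noteq> 1 / 2" using fr levx(3,4)[of j] unfolding m_def by linarith+
      then show "2 * \<phi> m z \<notin> \<int>" using frac_eq_0_iff[of "\<phi> m z"] twice_in_Ints_iff[of "\<phi> m z"] by blast
    qed
    then show False using levB[OF zFP] fr levx(3)[of j] by (auto simp: m_def)
  qed
  \<comment> \<open>Terms are added one at a time. The new sum \<open>t\<close> stays below 1, so it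
    is the fractional part of \<open>\<phi> m\<close> at the product. Either \<open>t\<close> is 0
    or 1/2, or the product itself has level \<open>m\<close> and, being in \<open>FP x\<close>, a
    value below 1/2.\<close>
  have bounded: "(\<Sum>j\<in>G. frac (\<phi> m (x j))) \<le> 1 / 2"
    if "finite G" "G \<noteq> {}" "\<And>j. j \<in> G \<Longrightarrow> lev (x j) = m" for G m
    using that
  proof (induction G rule: finite_ne_induct)
    case (singleton j)
    then show ?case using levx(4)[of j] by simp
  next
    case (insert j G)
    define t where "t = (\<Sum>j\<in>insert j G. frac (\<phi> m (x j)))"
    define z where "z = fprod x (insert j G)"
    have zFP: "z \<in> FP x" using insert.hyps by (simp add: z_def fprod_in_FP)
    have "0 \<le> t" unfolding t_def by (intro sum_nonneg frac_ge_0)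
    have "t < 1"
      using insert.IH insert.prems insert.hyps levx(4)[of j] by (auto simp: t_def)
    have z: "\<phi> l z - (\<Sum>j\<in>insert j G. \<phi> l (x j)) \<in> \<int>" for l
      unfolding z_def using insert.hyps by (intro character_fprod[OF levx(1) ch]) auto
    have "(\<phi> m z - (\<Sum>j\<in>insert j G. \<phi> m (x j))) + ((\<Sum>j\<in>insert j G. \<phi> m (x j)) - t) \<in> \<int>"
      unfolding t_def by (intro Ints_add z sum_diff_in_Ints diff_frac_in_Ints)
    then have fr: "frac (\<phi> m z) = t" using \<open>t < 1\<close> \<open>0 \<le> t\<close> by (intro frac_eqI) simp_all
    show ?case
    proof (cases "2 * \<phi> m z \<in> \<int>")
      case True
      then have "t = 0 \<or> t = 1 / 2" using fr frac_eq_0_iff[of "\<phi> m z"] by (simp add: twice_in_Ints_iff)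
      then show ?thesis by (auto simp: t_def)
    next
      case False
      have "lev z = m"
      proof (rule lev_eq[OF _ False], intro allI impI)
        fix l assume "l < m"
        then have "(\<Sum>j\<in>insert j G. 2 * \<phi> l (x j)) \<in> \<int>"
          using insert.prems by (intro Ints_sum levx(2)) auto
        then show "2 * \<phi> l z \<in> \<int>" using twice_sum[OF z[of l]] by (simp add: sum_distrib_left)
      qed
      then show ?thesis using levB[OF zFP] fr by (simp add: t_def)
    qed
  qed
  \<comment> \<open>The right-hand side is a finite union of complements of kernels, each outside
    \<open>p\<close> by \<open>character_kernel_in\<close>.\<close>
  have "FP_min x i \<subseteq> (\<Union>m\<le>lev (x i). U - {z \<in> U. \<phi> m z \<in> \<int>})"
  proof
    fix z assume "z \<in> FP_min x i"
    then obtain F where F: "finite F" "i \<in> F" "z = fprod x F" by (auto simp: FP_min_def)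
    have zU: "z \<in> U" using F levB[OF fprod_in_FP[of F x]] by auto
    define m where "m = Min ((\<lambda>j. lev (x j)) ` F)"
    have m: "m \<le> lev (x j)" if "j \<in> F" for j using F that by (simp add: m_def)
    have "m \<in> (\<lambda>j. lev (x j)) ` F" unfolding m_def using F by (intro Min_in) auto
    then obtain j where j: "j \<in> F" "m = lev (x j)" by auto
    \<comment> \<open>\<open>G\<close> collects the factors of least level \<open>m\<close>. By
      \<open>higher\<close>, the other factors contribute integers to \<open>\<phi> m\<close>, so
      the value at \<open>z\<close> is \<open>t\<close> modulo integers, with \<open>0 < t\<close>
      and \<open>t \<le> 1 / 2\<close>.\<close>
    define G where "G = {j \<in> F. lev (x j) = m}"
    have G: "finite G" "G \<noteq> {}" "G \<subseteq> F" using F j by (auto simp: G_def)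
    define t where "t = (\<Sum>j\<in>G. frac (\<phi> m (x j)))"
    have "t \<le> 1 / 2" unfolding t_def by (rule bounded) (use G G_def in auto)
    moreover have "0 < t" unfolding t_def using G levx(3) by (intro sum_pos) (auto simp: G_def)
    ultimately have "frac t \<noteq> 0" by (subst frac_eqI[of t t]) auto
    then have "t \<notin> \<int>" by (simp add: frac_eq_0_iff)
    have rest: "\<phi> m (x k) \<in> \<int>" if "k \<in> F - G" for k
      using higher[of j k] m[of k] j that by (auto simp: G_def)
    have "(\<phi> m z - (\<Sum>j\<in>F. \<phi> m (x j))) + ((\<Sum>j\<in>G. \<phi> m (x j)) - t) + (\<Sum>j\<in>F - G. \<phi> m (x j)) \<in> \<int>"
      unfolding t_def F(3) using F
      by (intro Ints_add character_fprod[OF levx(1) ch] sum_diff_in_Ints diff_frac_in_Ints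
          Ints_sum rest) auto
    moreover have "(\<Sum>j\<in>F. \<phi> m (x j)) = (\<Sum>j\<in>F - G. \<phi> m (x j)) + (\<Sum>j\<in>G. \<phi> m (x j))"
      using G F by (intro sum.subset_diff)
    ultimately have "\<phi> m z - t \<in> \<int>" by simp
    then have "\<phi> m z \<notin> \<int>" using \<open>t \<notin> \<int>\<close> Ints_diff_cong by blast
    then show "z \<in> (\<Union>m\<le>lev (x i). U - {z \<in> U. \<phi> m z \<in> \<int>})" using zU m[OF F(2)] by auto
  qed
  moreover have "\<dots> \<notin> p"
  proof (rule uf_UN[OF uf])
    fix m
    show "U - {z \<in> U. \<phi> m z \<in> \<int>} \<notin> p"
      using uf_Int[OF uf character_kernel_in[OF ch, of m]] uf_nonempty[OF uf] by blast
  qed simp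
  ultimately show "FP_min x i \<notin> p" using uf_mono[OF uf] by blast
qed

text \<open>Otherwise some FP-set in \<open>p\<close> has, for each element, a character whose
  double does not vanish there. An FP-set is countable, so these characters form a sequence, to
  which \<open>positive_level_notin\<close> applies.\<close>

lemma square_in_kernel: "{x \<in> U. x * x \<in> character_kernel U} \<in> p"
proof (rule ccontr)
  assume "{x \<in> U. x * x \<in> character_kernel U} \<notin> p"
  then have "U - {x \<in> U. x * x \<in> character_kernel U} \<in> p" by (rule uf_Diff[OF uf U])
  then obtain v where v: "FP v \<subseteq> U - {x \<in> U. x * x \<in> character_kernel U}" "FP v \<in> p"
    using sp_FP[OF sp] by blast
  have "\<exists>\<phi>. character_on U \<phi> \<and> 2 * \<phi> z \<notin> \<int>" if "z \<in> FP v" for z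
  proof -
    have z: "z \<in> U" "z * z \<notin> character_kernel U" using v that by auto
    then obtain \<phi> where \<phi>: "character_on U \<phi>" "\<phi> (z * z) \<notin> \<int>"
      using closed by (auto simp: character_kernel_def)
    then show ?thesis using Ints_diff_cong[OF character_mult[OF \<phi>(1) z(1) z(1)]] by auto
  qed
  then obtain \<chi> where \<chi>: "\<And>z. z \<in> FP v \<Longrightarrow> character_on U (\<chi> z) \<and> 2 * \<chi> z z \<notin> \<int>"
    by metis
  have "countable (FP v)"
    unfolding FP_def by (intro countable_image countable_subset[OF _ countable_Collect_finite]) auto
  then obtain e :: "nat \<Rightarrow> 'a" where e: "range e = FP v"
    using uf_nonempty[OF uf v(2)] by (metis range_from_nat_into)
  define \<phi> where "\<phi> n = \<chi> (e n)" for n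
  have ch: "character_on U (\<phi> n)" for n using \<chi> e by (auto simp: \<phi>_def)
  let ?B = "\<lambda>\<phi>. {x \<in> U. \<exists>n::nat. (\<forall>m<n. 2 * \<phi> m x \<in> \<int>) \<and> 0 < frac (\<phi> n x) \<and> frac (\<phi> n x) < (1 / 2 :: real)}"
  have "FP v \<subseteq> ?B \<phi> \<union> ?B (\<lambda>n x. - \<phi> n x)"
  proof
    fix z assume z: "z \<in> FP v"
    then obtain n0 where "2 * \<phi> n0 z \<notin> \<int>" using \<chi> e by (metis \<phi>_def imageE)
    then obtain n where n: "2 * \<phi> n z \<notin> \<int>" "\<forall>m<n. 2 * \<phi> m z \<in> \<int>"
      using exists_least_iff[of "\<lambda>n. 2 * \<phi> n z \<notin> \<int>"] by blast
    moreover have "z \<in> U" using z v by blast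
    moreover have "\<forall>m<n. 2 * - \<phi> m z \<in> \<int>" using n(2) by simp
    ultimately show "z \<in> ?B \<phi> \<union> ?B (\<lambda>n x. - \<phi> n x)"
      using frac_or_frac_minus[OF n(1)] by blast
  qed
  \<comment> \<open>Inverting all characters preserves levels, so the first nonvanishing double puts
    each element into one of the two sets.\<close>
  moreover have "?B \<phi> \<union> ?B (\<lambda>n x. - \<phi> n x) \<notin> p"
    by (intro uf_Un[OF uf] positive_level_notin ch character_uminus)
  ultimately show False using uf_mono[OF uf v(2)] by blast
qed

text \<open>Where squares lie in the kernel, characters have values of order two, so the value at a
  product depends on its index set only through symmetric differences. Two elements of
  \<open>FP_min x i\<close> whose product is again there force a product of terms of
  \<open>x\<close> into the kernel.\<close>

theorem common_kernel_in: "character_kernel U \<in> p"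
proof (rule ccontr)
  let ?K = "character_kernel U"
  let ?B = "{x \<in> U. x * x \<in> ?K} - ?K"
  assume "?K \<notin> p"
  then have "?B \<in> p" by (rule uf_Diff[OF uf square_in_kernel])
  moreover have "?B \<notin> p"
  proof (rule criterion, rule notI)
    fix x :: "nat \<Rightarrow> 'a" and i
    assume x: "FP x \<subseteq> ?B" and "FP_min x i \<in> p"
    then obtain y where y: "FP y \<subseteq> FP_min x i" using sp_FP[OF sp] by blast
    have xU: "x j \<in> U" for j using x term_in_FP[of x j] by auto
    have "y 0 \<in> FP_min x i" "y 1 \<in> FP_min x i" "y 0 * y 1 \<in> FP_min x i"
      using y term_in_FP[of y] mult_in_FP[of 0 1 y] by auto
    then obtain A B C where ABC: "finite A" "i \<in> A" "y 0 = fprod x A" "finite B" "i \<in> B" "y 1 = fprod x B"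
      "finite C" "i \<in> C" "y 0 * y 1 = fprod x C"
      unfolding FP_min_def by blast
    \<comment> \<open>The index \<open>i\<close> lies in all three sets, hence in \<open>D\<close>,
      which is therefore nonempty. The sums over \<open>A\<close> and \<open>B\<close> together
      agree with the sum over \<open>C\<close> modulo integers, so the sum over \<open>D\<close>
      vanishes.\<close>
    define D where "D = sym_diff (sym_diff A B) C"
    have D: "finite D" "D \<noteq> {}" using ABC by (auto simp: D_def)
    have "\<phi> (fprod x D) \<in> \<int>" if ch: "character_on U \<phi>" for \<phi>
    proof -
      define h where "h j = \<phi> (x j)" for j
      have h: "2 * h j \<in> \<int>" for j
      proof -
        have "\<phi> (x j * x j) \<in> \<int>"
          using x term_in_FP[of x j] ch by (auto simp: character_kernel_def)
        then show ?thesis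
          using Ints_diff_cong[OF character_mult[OF ch xU xU, of j j]] by (simp add: h_def)
      qed
      have prod: "\<phi> (fprod x F) - sum h F \<in> \<int>" if "finite F" "F \<noteq> {}" for F
        unfolding h_def using that by (intro character_fprod xU ch)
      have inU: "fprod x F \<in> U" if "finite F" "F \<noteq> {}" for F
        using fprod_closed_character[OF xU ch that] by simp
      have 1: "\<phi> (fprod x D) - sum h D \<in> \<int>" by (rule prod[OF D])
      have 2: "sum h A + sum h B - sum h (sym_diff A B) \<in> \<int>"
        by (intro sum_sym_diff_in_Ints ABC h)
      have 3: "sum h (sym_diff A B) + sum h C - sum h D \<in> \<int>"
        unfolding D_def by (intro sum_sym_diff_in_Ints h) (use ABC in auto)
      have ne: "A \<noteq> {}" "B \<noteq> {}" "C \<noteq> {}" using ABC by auto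
      have 4: "\<phi> (fprod x A * fprod x B) - (\<phi> (fprod x A) + \<phi> (fprod x B)) \<in> \<int>"
        by (intro character_mult[OF ch] inU ABC ne)
      have 5: "(\<Sum>j\<in>C. 2 * h j) \<in> \<int>" by (intro Ints_sum h)
      note prods = prod[OF ABC(1) ne(1)] prod[OF ABC(4) ne(2)] prod[OF ABC(7) ne(3)]
      \<comment> \<open>Everything cancels except \<open>\<phi> (fprod x D)\<close>, since
        \<open>fprod x A * fprod x B\<close> and \<open>fprod x C\<close> are the same
        element.\<close>
      have "(\<phi> (fprod x D) - sum h D) - (sum h A + sum h B - sum h (sym_diff A B))
         - (sum h (sym_diff A B) + sum h C - sum h D)
         - (\<phi> (fprod x A) - sum h A) - (\<phi> (fprod x B) - sum h B)
         - (\<phi> (fprod x A * fprod x B) - (\<phi> (fprod x A) + \<phi> (fprod x B)))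
         + (\<phi> (fprod x C) - sum h C) + (\<Sum>j\<in>C. 2 * h j) \<in> \<int>"
        by (rule Ints_add[OF Ints_add[OF Ints_diff[OF Ints_diff[OF Ints_diff[OF Ints_diff[OF
            Ints_diff[OF 1 2] 3] prods(1)] prods(2)] 4] prods(3)] 5])
      then show ?thesis using ABC(3,6,9) by (simp add: sum_distrib_left[symmetric])
    qed
    moreover have "fprod x D \<in> ?B" using x D fprod_in_FP by blast
    ultimately show False by (auto simp: character_kernel_def)
  qed
  ultimately show False by blast
qed

end

section \<open>Separation by characters\<close>

text \<open>Modulo pointwise \<open>R\<close>-equivalence, \<open>M\<close> is a commutative
  cancellative monoid. Using maps instead of elements supplies the unit \<open>id\<close>, and
  characters can be extended without forming the group completion.\<close>

locale commuting_maps =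
  fixes U :: "'a set" and R :: "('a \<times> 'a) set" and M :: "('a \<Rightarrow> 'a) set"
  assumes equiv: "equiv U R"
    and id_M: "id \<in> M"
    and comp_M: "f \<in> M \<Longrightarrow> g \<in> M \<Longrightarrow> f \<circ> g \<in> M"
    and maps: "f \<in> M \<Longrightarrow> c \<in> U \<Longrightarrow> f c \<in> U"
    and cancel: "f \<in> M \<Longrightarrow> c \<in> U \<Longrightarrow> d \<in> U \<Longrightarrow> (f c, f d) \<in> R \<longleftrightarrow> (c, d) \<in> R"
    and commute: "f \<in> M \<Longrightarrow> g \<in> M \<Longrightarrow> c \<in> U \<Longrightarrow> (f (g c), g (f c)) \<in> R"
begin

section \<open>The quotient monoid and its partial characters\<close>

definition sim :: "('a \<Rightarrow> 'a) \<Rightarrow> ('a \<Rightarrow> 'a) \<Rightarrow> bool" (infix "\<approx>" 50) where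
  "f \<approx> g \<longleftrightarrow> (\<forall>c\<in>U. (f c, g c) \<in> R)"

lemma R_refl: "c \<in> U \<Longrightarrow> (c, c) \<in> R"
  using equiv by (meson equivE refl_onD)

lemma R_sym: "(c, d) \<in> R \<Longrightarrow> (d, c) \<in> R"
  using equiv by (meson equivE symD)

lemma R_trans [trans]: "(c, d) \<in> R \<Longrightarrow> (d, e) \<in> R \<Longrightarrow> (c, e) \<in> R"
  using equiv by (meson equivE transD)

lemma sim_refl: "f \<in> M \<Longrightarrow> f \<approx> f"
  by (simp add: sim_def R_refl maps)

lemma sim_sym: "f \<approx> g \<Longrightarrow> g \<approx> f"
  by (auto simp: sim_def intro: R_sym)

lemma sim_trans [trans]: "f \<approx> g \<Longrightarrow> g \<approx> h \<Longrightarrow> f \<approx> h"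
  by (auto simp: sim_def intro: R_trans)

lemma sim_comp:
  assumes "f \<approx> f'" "g \<approx> g'" "f \<in> M" "g \<in> M" "g' \<in> M"
  shows "f \<circ> g \<approx> f' \<circ> g'"
  unfolding sim_def
proof
  fix c assume c: "c \<in> U"
  have "(f (g c), f (g' c)) \<in> R" using assms c by (simp add: sim_def cancel maps)
  also have "(f (g' c), f' (g' c)) \<in> R" using assms c by (simp add: sim_def maps)
  finally show "((f \<circ> g) c, (f' \<circ> g') c) \<in> R" by simp
qed

lemma sim_commute: "f \<in> M \<Longrightarrow> g \<in> M \<Longrightarrow> f \<circ> g \<approx> g \<circ> f"
  by (simp add: sim_def commute)

lemma sim_cancel:
  assumes "h \<circ> f \<approx> h \<circ> g" "f \<in> M" "g \<in> M" "h \<in> M"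
  shows "f \<approx> g"
  using assms by (simp add: sim_def cancel maps)

lemma funpow_M: "z \<in> M \<Longrightarrow> z ^^ k \<in> M"
  by (induction k) (auto simp: id_M comp_M simp flip: id_def)

text \<open>The graph of a character on a submonoid. It is a relation because real values matter
  only modulo integers and several representatives may occur.\<close>

definition partial_character :: "(('a \<Rightarrow> 'a) \<times> real) set \<Rightarrow> bool" where
  "partial_character \<Gamma> \<longleftrightarrow> \<Gamma> \<subseteq> M \<times> UNIV \<and> (id, 0) \<in> \<Gamma> \<and>
     (\<forall>f s g t. (f, s) \<in> \<Gamma> \<longrightarrow> (g, t) \<in> \<Gamma> \<longrightarrow> (f \<circ> g, s + t) \<in> \<Gamma>) \<and>
     (\<forall>f s g t. (f, s) \<in> \<Gamma> \<longrightarrow> (g, t) \<in> \<Gamma> \<longrightarrow> f \<approx> g \<longrightarrow> s - t \<in> \<int>)"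

lemma
  assumes "partial_character \<Gamma>"
  shows pc_M: "(f, s) \<in> \<Gamma> \<Longrightarrow> f \<in> M"
    and pc_id: "(id, 0) \<in> \<Gamma>"
    and pc_comp: "(f, s) \<in> \<Gamma> \<Longrightarrow> (g, t) \<in> \<Gamma> \<Longrightarrow> (f \<circ> g, s + t) \<in> \<Gamma>"
    and pc_consistent: "(f, s) \<in> \<Gamma> \<Longrightarrow> (g, t) \<in> \<Gamma> \<Longrightarrow> f \<approx> g \<Longrightarrow> s - t \<in> \<int>"
  using assms unfolding partial_character_def by blast+

text \<open>The compatibility condition for giving \<open>z\<close> the value \<open>w\<close>: each
  relation that expresses a positive power of \<open>z\<close> as a quotient from the domain of
  \<open>\<Gamma>\<close> must prescribe the value \<open>j * w\<close>.\<close>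

definition adjoinable :: "(('a \<Rightarrow> 'a) \<times> real) set \<Rightarrow> ('a \<Rightarrow> 'a) \<Rightarrow> real \<Rightarrow> bool" where
  "adjoinable \<Gamma> z w \<longleftrightarrow> (\<forall>j f s g t. 0 < j \<longrightarrow> (f, s) \<in> \<Gamma> \<longrightarrow> (g, t) \<in> \<Gamma> \<longrightarrow>
     f \<approx> (z ^^ j) \<circ> g \<longrightarrow> s - t - real j * w \<in> \<int>)"

definition adjoin :: "(('a \<Rightarrow> 'a) \<times> real) set \<Rightarrow> ('a \<Rightarrow> 'a) \<Rightarrow> real \<Rightarrow> (('a \<Rightarrow> 'a) \<times> real) set" where
  "adjoin \<Gamma> z w = {(f', s + real k * w) | f' k f s. f' \<in> M \<and> (f, s) \<in> \<Gamma> \<and> f' \<approx> (z ^^ k) \<circ> f}"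

text \<open>Cancelling \<open>z ^^ k\<close> leaves the exponent \<open>l - k\<close>: consistency
  of \<open>\<Gamma>\<close> handles exponent 0, and \<open>adjoinable\<close> the positive
  ones.\<close>

lemma adjoin_consistent:
  assumes pc: "partial_character \<Gamma>" and z: "z \<in> M" and w: "adjoinable \<Gamma> z w"
    and f: "(f, s) \<in> \<Gamma>" and g: "(g, t) \<in> \<Gamma>" and sim: "(z ^^ k) \<circ> f \<approx> (z ^^ l) \<circ> g" and kl: "k \<le> l"
  shows "(s + real k * w) - (t + real l * w) \<in> \<int>"
proof -
  have "(z ^^ l) = (z ^^ k) \<circ> (z ^^ (l - k))" using kl by (simp flip: funpow_add)
  then have "(z ^^ k) \<circ> f \<approx> (z ^^ k) \<circ> ((z ^^ (l - k)) \<circ> g)" using sim by (simp add: comp_assoc)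
  then have sim': "f \<approx> (z ^^ (l - k)) \<circ> g"
    by (rule sim_cancel) (intro funpow_M comp_M z pc_M[OF pc f] pc_M[OF pc g])+
  have "s - t - real (l - k) * w \<in> \<int>"
  proof (cases "l - k = 0")
    case True
    then show ?thesis using pc_consistent[OF pc f g] sim' by simp
  next
    case False
    then show ?thesis using w f g sim' unfolding adjoinable_def by blast
  qed
  then show ?thesis using kl by (simp add: of_nat_diff algebra_simps)
qed

lemma adjoin_partial_character:
  assumes pc: "partial_character \<Gamma>" and z: "z \<in> M" and w: "adjoinable \<Gamma> z w"
  shows "partial_character (adjoin \<Gamma> z w)" "\<Gamma> \<subseteq> adjoin \<Gamma> z w" "(z, w) \<in> adjoin \<Gamma> z w"
proof -
  show sub: "\<Gamma> \<subseteq> adjoin \<Gamma> z w"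
  proof clarify
    fix f s assume f: "(f, s) \<in> \<Gamma>"
    have "f \<approx> (z ^^ 0) \<circ> f" using sim_refl[OF pc_M[OF pc f]] by (simp flip: id_def)
    then show "(f, s) \<in> adjoin \<Gamma> z w"
      unfolding adjoin_def using f pc_M[OF pc f] by (force intro!: exI[of _ 0])
  qed
  have "z \<approx> (z ^^ 1) \<circ> id" using sim_refl[OF z] by simp
  then show "(z, w) \<in> adjoin \<Gamma> z w"
    unfolding adjoin_def using z pc_id[OF pc] by (force intro!: exI[of _ 1])
  have comp: "(f' \<circ> g', s + t) \<in> adjoin \<Gamma> z w"
    if f': "(f', s) \<in> adjoin \<Gamma> z w" and g': "(g', t) \<in> adjoin \<Gamma> z w" for f' s g' t
  proof -
    obtain k f s0 where f: "f' \<in> M" "(f, s0) \<in> \<Gamma>" "f' \<approx> (z ^^ k) \<circ> f" "s = s0 + real k * w"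
      using f' unfolding adjoin_def by blast
    obtain l g t0 where g: "g' \<in> M" "(g, t0) \<in> \<Gamma>" "g' \<approx> (z ^^ l) \<circ> g" "t = t0 + real l * w"
      using g' unfolding adjoin_def by blast
    note M = f(1) g(1) pc_M[OF pc f(2)] pc_M[OF pc g(2)] funpow_M[OF z, of k] funpow_M[OF z, of l]
    have "f' \<circ> g' \<approx> ((z ^^ k) \<circ> f) \<circ> ((z ^^ l) \<circ> g)"
      by (intro sim_comp f g M comp_M)
    also have "((z ^^ k) \<circ> f) \<circ> ((z ^^ l) \<circ> g) = (z ^^ k) \<circ> ((f \<circ> (z ^^ l)) \<circ> g)"
      by (simp add: comp_assoc)
    also have "\<dots> \<approx> (z ^^ k) \<circ> (((z ^^ l) \<circ> f) \<circ> g)"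
      by (intro sim_comp sim_refl sim_commute M comp_M)
    also have "\<dots> = (z ^^ (k + l)) \<circ> (f \<circ> g)" by (simp add: funpow_add comp_assoc)
    finally have sim: "f' \<circ> g' \<approx> (z ^^ (k + l)) \<circ> (f \<circ> g)" .
    have "s + t = (s0 + t0) + real (k + l) * w" by (simp add: f g algebra_simps)
    then show ?thesis
      unfolding adjoin_def using sim comp_M[OF f(1) g(1)] pc_comp[OF pc f(2) g(2)] by blast
  qed
  have consistent: "s - t \<in> \<int>"
    if f': "(f', s) \<in> adjoin \<Gamma> z w" and g': "(g', t) \<in> adjoin \<Gamma> z w" and sim': "f' \<approx> g'" for f' s g' t
  proof -
    obtain k f s0 where f: "f' \<in> M" "(f, s0) \<in> \<Gamma>" "f' \<approx> (z ^^ k) \<circ> f" "s = s0 + real k * w"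
      using f' unfolding adjoin_def by blast
    obtain l g t0 where g: "g' \<in> M" "(g, t0) \<in> \<Gamma>" "g' \<approx> (z ^^ l) \<circ> g" "t = t0 + real l * w"
      using g' unfolding adjoin_def by blast
    have sim: "(z ^^ k) \<circ> f \<approx> (z ^^ l) \<circ> g"
      using sim_trans[OF sim_trans[OF sim_sym[OF f(3)] sim'] g(3)] .
    show ?thesis
    proof (cases "k \<le> l")
      case True
      then show ?thesis using adjoin_consistent[OF pc z w f(2) g(2) sim] f(4) g(4) by simp
    next
      case False
      then have "t - s \<in> \<int>"
        using adjoin_consistent[OF pc z w g(2) f(2) sim_sym[OF sim]] f(4) g(4) by simp
      then show ?thesis using Ints_minus by fastforce
    qed
  qed
  have "adjoin \<Gamma> z w \<subseteq> M \<times> UNIV" by (auto simp: adjoin_def)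
  then show "partial_character (adjoin \<Gamma> z w)"
    unfolding partial_character_def using sub pc_id[OF pc] comp consistent by blast
qed

text \<open>The least exponent in a relation \<open>f \<approx> z\<^sup>j \<circ> g\<close> generates all of them, since
  \<open>f \<approx> z\<^sup>j \<circ> g\<close> and \<open>f0 \<approx> z\<^sup>m \<circ> g0\<close> give \<open>f \<circ> g0 \<approx> z\<^sup>j\<^sup>-\<^sup>m \<circ> (g \<circ> f0)\<close>.\<close>
lemma adjoinable_least:
  assumes pc: "partial_character \<Gamma>" and z: "z \<in> M"
    and f0: "(f0, s0) \<in> \<Gamma>" and g0: "(g0, t0) \<in> \<Gamma>" and sim0: "f0 \<approx> (z ^^ m) \<circ> g0"
    and m: "0 < m" and least: "\<forall>j f s g t. 0 < j \<longrightarrow> j < m \<longrightarrow> (f, s) \<in> \<Gamma> \<longrightarrow> (g, t) \<in> \<Gamma> \<longrightarrow>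
       \<not> f \<approx> (z ^^ j) \<circ> g"
    and w: "s0 - t0 - real m * w \<in> \<int>"
  shows "adjoinable \<Gamma> z w"
proof -
  have "s - t - real j * w \<in> \<int>"
    if "0 < j" "(f, s) \<in> \<Gamma>" "(g, t) \<in> \<Gamma>" "f \<approx> (z ^^ j) \<circ> g" for j f s g t
    using that
  proof (induction j arbitrary: f s g t rule: less_induct)
    case (less j)
    note f = less.prems(2) and g = less.prems(3) and sim = less.prems(4)
    have mj: "m \<le> j" using least less.prems by (meson not_le)
    note M = pc_M[OF pc f] pc_M[OF pc g] pc_M[OF pc f0] pc_M[OF pc g0]
      funpow_M[OF z, of j] funpow_M[OF z, of "j - m"] funpow_M[OF z, of m]
    have "f \<circ> g0 \<approx> ((z ^^ j) \<circ> g) \<circ> g0"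
      by (intro sim_comp sim sim_refl M comp_M)
    also have "((z ^^ j) \<circ> g) \<circ> g0 = (z ^^ (j - m)) \<circ> ((z ^^ m) \<circ> (g \<circ> g0))"
    proof -
      have "z ^^ j = (z ^^ (j - m)) \<circ> (z ^^ m)" using mj by (simp flip: funpow_add)
      then show ?thesis by (simp add: comp_assoc)
    qed
    also have "\<dots> \<approx> (z ^^ (j - m)) \<circ> ((z ^^ m) \<circ> (g0 \<circ> g))"
      by (intro sim_comp sim_refl sim_commute M comp_M)
    also have "(z ^^ (j - m)) \<circ> ((z ^^ m) \<circ> (g0 \<circ> g)) = (z ^^ (j - m)) \<circ> (((z ^^ m) \<circ> g0) \<circ> g)"
      by (simp add: comp_assoc)
    also have "\<dots> \<approx> (z ^^ (j - m)) \<circ> (f0 \<circ> g)"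
      by (intro sim_comp sim_refl sim_sym[OF sim0] M comp_M)
    finally have sim': "f \<circ> g0 \<approx> (z ^^ (j - m)) \<circ> (f0 \<circ> g)" .
    have "(s + t0) - (s0 + t) - real (j - m) * w \<in> \<int>"
    proof (cases "j = m")
      case True
      then have "f \<circ> g0 \<approx> f0 \<circ> g" using sim' by (simp flip: id_def)
      then show ?thesis
        using pc_consistent[OF pc pc_comp[OF pc f g0] pc_comp[OF pc f0 g]] True by simp
    next
      case False
      then show ?thesis
        using less.IH[OF _ _ pc_comp[OF pc f g0] pc_comp[OF pc f0 g] sim'] mj m by simp
    qed
    from Ints_add[OF this w] show ?case using mj by (simp add: of_nat_diff algebra_simps)
  qed
  then show ?thesis unfolding adjoinable_def by blast
qed

text \<open>Without any relation, every \<open>w\<close> would be adjoinable vacuously.\<close>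

lemma least_relation:
  assumes "\<not> adjoinable \<Gamma> z w"
  obtains m f0 s0 g0 t0 where "0 < m" "(f0, s0) \<in> \<Gamma>" "(g0, t0) \<in> \<Gamma>" "f0 \<approx> (z ^^ m) \<circ> g0"
    "\<forall>j f s g t. 0 < j \<longrightarrow> j < m \<longrightarrow> (f, s) \<in> \<Gamma> \<longrightarrow> (g, t) \<in> \<Gamma> \<longrightarrow> \<not> f \<approx> (z ^^ j) \<circ> g"
proof -
  define P where "P j \<longleftrightarrow> 0 < j \<and> (\<exists>f s g t. (f, s) \<in> \<Gamma> \<and> (g, t) \<in> \<Gamma> \<and> f \<approx> (z ^^ j) \<circ> g)" for j
  have "\<exists>j. P j" using assms unfolding adjoinable_def P_def by blast
  then obtain m where m: "P m" "\<And>j. j < m \<Longrightarrow> \<not> P j" using exists_least_iff[of P] by blast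
  then show ?thesis using that unfolding P_def by blast
qed

text \<open>The circle is divisible: if a relation exists, the value prescribed by the least one is
  divided by its exponent.\<close>

lemma adjoinable_exists:
  assumes pc: "partial_character \<Gamma>" and z: "z \<in> M"
  shows "\<exists>w. adjoinable \<Gamma> z w"
proof (rule ccontr)
  assume *: "\<nexists>w. adjoinable \<Gamma> z w"
  then have False0: "\<not> adjoinable \<Gamma> z 0" by blast
  obtain m f0 s0 g0 t0 where m: "0 < m" "(f0, s0) \<in> \<Gamma>" "(g0, t0) \<in> \<Gamma>" "f0 \<approx> (z ^^ m) \<circ> g0"
    "\<forall>j f s g t. 0 < j \<longrightarrow> j < m \<longrightarrow> (f, s) \<in> \<Gamma> \<longrightarrow> (g, t) \<in> \<Gamma> \<longrightarrow> \<not> f \<approx> (z ^^ j) \<circ> g"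
    by (rule least_relation[OF False0]) (rule that; assumption)
  have "adjoinable \<Gamma> z ((s0 - t0) / real m)"
    by (rule adjoinable_least[OF pc z m(2,3,4,1,5)]) (use m in auto)
  then show False using * by blast
qed

text \<open>A character on the powers of \<open>h\<close> that is nontrivial at \<open>h\<close> is
  extended by Zorn's lemma; a maximal extension is total, since any further map could be
  adjoined.\<close>

theorem character_nontrivial_at:
  assumes h: "h \<in> M" and nontriv: "\<not> h \<approx> id"
  obtains \<phi> :: "('a \<Rightarrow> 'a) \<Rightarrow> real"
  where "\<And>f g. f \<in> M \<Longrightarrow> g \<in> M \<Longrightarrow> \<phi> (f \<circ> g) - (\<phi> f + \<phi> g) \<in> \<int>" "\<phi> h \<notin> \<int>"
proof -
  let ?\<Gamma>0 = "{(id, 0)} :: (('a \<Rightarrow> 'a) \<times> real) set"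
  have pc0: "partial_character ?\<Gamma>0" by (auto simp: partial_character_def id_M)
  \<comment> \<open>If 1/2 is incompatible, then \<open>h\<close> has a finite order
    \<open>m\<close> modulo \<open>sim\<close>. As \<open>h\<close> is not the identity there,
    \<open>m > 1\<close>, and \<open>1 / m\<close> is a nontrivial compatible value.\<close>
  have "\<exists>w. adjoinable ?\<Gamma>0 h w \<and> w \<notin> \<int>"
  proof (cases "adjoinable ?\<Gamma>0 h (1 / 2)")
    case True
    moreover have "frac (1 / 2 :: real) = 1 / 2" by (rule frac_eqI) auto
    then have "(1 / 2 :: real) \<notin> \<int>" by (simp flip: frac_eq_0_iff)
    ultimately show ?thesis by blast
  next
    case False
    obtain m f0 s0 g0 t0 where m: "0 < m" "(f0, s0) \<in> ?\<Gamma>0" "(g0, t0) \<in> ?\<Gamma>0"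
      "f0 \<approx> (h ^^ m) \<circ> g0"
      "\<forall>j f s g t. 0 < j \<longrightarrow> j < m \<longrightarrow> (f, s) \<in> ?\<Gamma>0 \<longrightarrow> (g, t) \<in> ?\<Gamma>0 \<longrightarrow> \<not> f \<approx> (h ^^ j) \<circ> g"
      by (rule least_relation[OF False]) (rule that; assumption)
    have "adjoinable ?\<Gamma>0 h (1 / real m)"
      by (rule adjoinable_least[OF pc0 h m(2,3,4,1,5)]) (use m in auto)
    moreover have "m \<noteq> 1" using m(2-4) nontriv sim_sym[of id h] by auto
    then have "1 < m" using m(1) by simp
    then have "frac (1 / real m) = 1 / real m" by (intro frac_eqI) auto
    then have "1 / real m \<notin> \<int>" using m(1) by (simp flip: frac_eq_0_iff)
    ultimately show ?thesis by blast
  qed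
  then obtain w where w: "adjoinable ?\<Gamma>0 h w" "w \<notin> \<int>" by blast
  let ?A = "{\<Gamma>. partial_character \<Gamma> \<and> (h, w) \<in> \<Gamma>}"
  have "\<exists>\<Gamma>\<in>?A. \<forall>\<Delta>\<in>?A. \<Gamma> \<subseteq> \<Delta> \<longrightarrow> \<Delta> = \<Gamma>"
  proof (rule subset_Zorn_nonempty)
    show "?A \<noteq> {}" using adjoin_partial_character[OF pc0 h w(1)] by blast
  next
    fix C assume C: "C \<noteq> {}" "subset.chain ?A C"
    have CA: "\<Gamma> \<in> C \<Longrightarrow> partial_character \<Gamma> \<and> (h, w) \<in> \<Gamma>" for \<Gamma>
      using C(2) by (auto simp: subset_chain_def)
    have two: "\<exists>\<Gamma>\<in>C. u \<in> \<Gamma> \<and> v \<in> \<Gamma>" if "u \<in> \<Union>C" "v \<in> \<Union>C" for u v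
      using that C(2) unfolding subset_chain_def by blast
    obtain \<Gamma>0 where "\<Gamma>0 \<in> C" using C(1) by blast
    then have base: "(id, 0) \<in> \<Union>C" "(h, w) \<in> \<Union>C" using CA pc_id by blast+
    have "\<Union>C \<subseteq> M \<times> UNIV" using CA pc_M by auto
    moreover have "(f \<circ> g, s + t) \<in> \<Union>C" if "(f, s) \<in> \<Union>C" "(g, t) \<in> \<Union>C" for f s g t
      using two[OF that] CA pc_comp by blast
    moreover have "s - t \<in> \<int>" if "(f, s) \<in> \<Union>C" "(g, t) \<in> \<Union>C" "f \<approx> g" for f s g t
      using two[OF that(1,2)] CA pc_consistent that(3) by blast
    ultimately have "partial_character (\<Union>C)"
      unfolding partial_character_def using base by blast
    then show "\<Union>C \<in> ?A" using base by blast
  qed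
  then obtain \<Gamma> where \<Gamma>: "partial_character \<Gamma>" "(h, w) \<in> \<Gamma>"
    and max: "\<And>\<Delta>. partial_character \<Delta> \<Longrightarrow> \<Gamma> \<subseteq> \<Delta> \<Longrightarrow> \<Delta> = \<Gamma>"
    by blast
  have total: "\<exists>s. (f, s) \<in> \<Gamma>" if f: "f \<in> M" for f
    using adjoinable_exists[OF \<Gamma>(1) f] adjoin_partial_character[OF \<Gamma>(1) f] max by blast
  define \<phi> where "\<phi> f = (SOME s. (f, s) \<in> \<Gamma>)" for f
  have \<phi>: "(f, \<phi> f) \<in> \<Gamma>" if "f \<in> M" for f
    unfolding \<phi>_def using total[OF that] by (rule someI_ex)
  have "\<phi> h - w \<in> \<int>" by (rule pc_consistent[OF \<Gamma>(1) \<phi>[OF h] \<Gamma>(2) sim_refl[OF h]])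
  then have "\<phi> h \<notin> \<int>" using w(2) Ints_diff_cong by blast
  moreover have "\<phi> (f \<circ> g) - (\<phi> f + \<phi> g) \<in> \<int>" if "f \<in> M" "g \<in> M" for f g
    using pc_consistent[OF \<Gamma>(1) \<phi>[OF comp_M[OF that]] pc_comp[OF \<Gamma>(1) \<phi>[OF that(1)] \<phi>[OF that(2)]]]
      sim_refl[OF comp_M[OF that]] by blast
  ultimately show ?thesis using that by blast
qed

end

section \<open>Congruences with commutative quotient\<close>

lemma congruence_onD:
  assumes "congruence_on T r"
  shows congruence_refl: "x \<in> T \<Longrightarrow> (x, x) \<in> r"
    and congruence_sym: "(x, y) \<in> r \<Longrightarrow> (y, x) \<in> r"
    and congruence_trans: "(x, y) \<in> r \<Longrightarrow> (y, z) \<in> r \<Longrightarrow> (x, z) \<in> r"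
    and congruence_left: "(x, y) \<in> r \<Longrightarrow> z \<in> T \<Longrightarrow> (z * x, z * y) \<in> r"
    and congruence_right: "(x, y) \<in> r \<Longrightarrow> z \<in> T \<Longrightarrow> (x * z, y * z) \<in> r"
proof -
  have "equiv T r" using assms by (simp add: congruence_on_def)
  then show "x \<in> T \<Longrightarrow> (x, x) \<in> r" "(x, y) \<in> r \<Longrightarrow> (y, x) \<in> r"
    "(x, y) \<in> r \<Longrightarrow> (y, z) \<in> r \<Longrightarrow> (x, z) \<in> r"
    by (meson equivE refl_onD symD transD)+
qed (use assms in \<open>auto simp: congruence_on_def\<close>)

text \<open>Elements of \<open>U\<close> act on \<open>U\<close> by left multiplication. If
  \<open>x\<close> acted nontrivially on the cancellative quotient, a separating character of these
  maps would restrict to a character on \<open>U\<close> with noninteger value at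
  \<open>x\<close>.\<close>

lemma character_kernel_trivial:
  assumes cong: "congruence_on T r" and comm: "\<And>x y. x \<in> T \<Longrightarrow> y \<in> T \<Longrightarrow> (x * y, y * x) \<in> r"
    and UT: "U \<subseteq> T" and closed: "\<And>x y. x \<in> U \<Longrightarrow> y \<in> U \<Longrightarrow> x * y \<in> U"
    and x: "x \<in> character_kernel U"
  shows "\<exists>c\<in>U. (c * x, c) \<in> r"
proof -
  note refl = congruence_refl[OF cong] and sym = congruence_sym[OF cong]
    and trans [trans] = congruence_trans[OF cong]
    and left = congruence_left[OF cong] and right = congruence_right[OF cong]
  have T: "u \<in> U \<Longrightarrow> u \<in> T" for u using UT by blast
  \<comment> \<open>This is the kernel of the map from \<open>U\<close> to the group completion of
    its image modulo \<open>r\<close>.\<close>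
  define R where "R = {(a, b). a \<in> U \<and> b \<in> U \<and> (\<exists>c\<in>U. (c * a, c * b) \<in> r)}"
  have swap: "(a * (b * c), b * (a * c)) \<in> r" if "a \<in> U" "b \<in> U" "c \<in> U" for a b c
    using right[OF comm[OF T T], of a b c] that T by (simp add: mult.assoc)
  interpret commuting_maps U R "insert id ((\<lambda>u y. u * y) ` U)"
  proof
    show "equiv U R"
    proof (rule equivI)
      show "R \<subseteq> U \<times> U" by (auto simp: R_def)
      show "refl_on U R" unfolding refl_on_def R_def using refl T closed by blast
      show "Relation.sym R" unfolding sym_def R_def using sym by blast
      show "Relation.trans R"
      proof (rule transI)
        fix a b e assume "(a, b) \<in> R" "(b, e) \<in> R"
        then obtain c d where *: "a \<in> U" "b \<in> U" "e \<in> U" "c \<in> U" "(c * a, c * b) \<in> r"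
          "d \<in> U" "(d * b, d * e) \<in> r" by (auto simp: R_def)
        have "(d * (c * a), d * (c * b)) \<in> r" by (rule left[OF *(5) T[OF *(6)]])
        also have "(d * (c * b), c * (d * b)) \<in> r" using * by (intro swap)
        also have "(c * (d * b), c * (d * e)) \<in> r" by (rule left[OF *(7) T[OF *(4)]])
        also have "(c * (d * e), d * (c * e)) \<in> r" using * by (intro swap)
        finally have "((d * c) * a, (d * c) * e) \<in> r" by (simp add: mult.assoc)
        then show "(a, e) \<in> R" unfolding R_def using * closed by blast
      qed
    qed
  next
    fix f g assume f: "f \<in> insert id ((\<lambda>u y. u * y) ` U)" and g: "g \<in> insert id ((\<lambda>u y. u * y) ` U)"
    have "(\<lambda>y. u * y) \<circ> (\<lambda>y. v * y) = (\<lambda>y. (u * v) * y)" for u v :: 'a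
      by (auto simp: mult.assoc)
    then show "f \<circ> g \<in> insert id ((\<lambda>u y. u * y) ` U)"
      using f g closed by auto
    fix c assume c: "c \<in> U"
    show "f c \<in> U" using f c closed by auto
    have refl': "(a, a) \<in> R" if "a \<in> U" for a
      unfolding R_def using that refl T closed by blast
    show "(f (g c), g (f c)) \<in> R"
    proof (cases "f = id \<or> g = id")
      case True
      then show ?thesis using f g c closed by (auto intro!: refl')
    next
      case False
      then obtain u v where uv: "u \<in> U" "v \<in> U" "f = (\<lambda>y. u * y)" "g = (\<lambda>y. v * y)"
        using f g by auto
      have "(c * (u * (v * c)), c * (v * (u * c))) \<in> r" using uv c T by (intro left swap)
      then show ?thesis unfolding R_def using uv c closed by auto
    qed
    fix d assume d: "d \<in> U"
    show "(f c, f d) \<in> R \<longleftrightarrow> (c, d) \<in> R"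
    proof (cases "f = id")
      case False
      then obtain u where u: "u \<in> U" "f = (\<lambda>y. u * y)" using f by auto
      show ?thesis
      proof
        assume "(f c, f d) \<in> R"
        then obtain e where e: "e \<in> U" "(e * (u * c), e * (u * d)) \<in> r" by (auto simp: R_def u)
        then have "((e * u) * c, (e * u) * d) \<in> r" by (simp add: mult.assoc)
        then show "(c, d) \<in> R" unfolding R_def using e u c d closed by blast
      next
        assume "(c, d) \<in> R"
        then obtain e where e: "e \<in> U" "(e * c, e * d) \<in> r" by (auto simp: R_def)
        have "(e * (u * c), u * (e * c)) \<in> r" using e u c by (intro swap)
        also have "(u * (e * c), u * (e * d)) \<in> r" by (rule left[OF e(2) T[OF u(1)]])
        also have "(u * (e * d), e * (u * d)) \<in> r" using e u d by (intro swap)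
        finally show "(f c, f d) \<in> R" unfolding R_def using e u c d closed by auto
      qed
    qed simp
  qed simp
  let ?l = "\<lambda>u y. u * y :: 'a"
  have xU: "x \<in> U" using x by (simp add: character_kernel_def)
  have "sim (?l x) id"
  proof (rule ccontr)
    assume "\<not> sim (?l x) id"
    then obtain \<phi> :: "('a \<Rightarrow> 'a) \<Rightarrow> real"
      where \<phi>: "\<And>f g. f \<in> insert id (?l ` U) \<Longrightarrow> g \<in> insert id (?l ` U) \<Longrightarrow> \<phi> (f \<circ> g) - (\<phi> f + \<phi> g) \<in> \<int>"
        and x': "\<phi> (?l x) \<notin> \<int>"
      using character_nontrivial_at[of "?l x"] xU by blast
    have "character_on U (\<lambda>u. \<phi> (?l u))"
      unfolding character_on_def
    proof (intro ballI)
      fix u v assume "u \<in> U" "v \<in> U"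
      then have "\<phi> (?l u \<circ> ?l v) - (\<phi> (?l u) + \<phi> (?l v)) \<in> \<int>" by (intro \<phi>) auto
      moreover have "?l u \<circ> ?l v = ?l (u * v)" by (auto simp: mult.assoc)
      ultimately show "\<phi> (?l (u * v)) - (\<phi> (?l u) + \<phi> (?l v)) \<in> \<int>" by simp
    qed
    then show False using x x' by (auto simp: character_kernel_def)
  qed
  \<comment> \<open>Evaluating the trivial action at \<open>x\<close> itself gives a
    \<open>d\<close> for which \<open>d * x\<close> is the required witness.\<close>
  then have "(x * x, x) \<in> R" using xU by (auto simp: sim_def)
  then obtain d where "d \<in> U" "(d * (x * x), d * x) \<in> r" by (auto simp: R_def)
  then show ?thesis using closed[of d x] xU by (auto simp: mult.assoc intro!: bexI[of _ "d * x"])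
qed

section \<open>Solvable inverse semigroups\<close>

text \<open>Let \<open>a\<close> be the inverse of \<open>e * f\<close>. Then
  \<open>f * (a * e)\<close> is an inverse too, so it equals \<open>a\<close>, which makes
  \<open>a\<close> idempotent. Hence \<open>a\<close> is its own inverse, and uniqueness gives
  \<open>e * f = a\<close>.\<close>

lemma inverse_semigroup_idempotent_mult:
  assumes inv: "inverse_semigroup_on T" and T: "e \<in> T" "f \<in> T" and e: "e * e = e" and f: "f * f = f"
  shows "(e * f) * (e * f) = e * f"
proof -
  note assoc = mult.assoc
  have closed: "a \<in> T \<Longrightarrow> b \<in> T \<Longrightarrow> a * b \<in> T" for a b
    using inv by (auto simp: inverse_semigroup_on_def)
  have unique: "y = z" if "a \<in> T" "y \<in> T" "z \<in> T" "a * y * a = a" "y * a * y = y" "a * z * a = a"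
    "z * a * z = z" for a y z
    using inv that unfolding inverse_semigroup_on_def by blast
  obtain a where a: "a \<in> T" "(e * f) * a * (e * f) = e * f" "a * (e * f) * a = a"
    using inv closed[OF T] unfolding inverse_semigroup_on_def by blast
  have e': "e * (e * b) = e * b" for b using e by (simp flip: assoc)
  have f': "f * (f * b) = f * b" for b using f by (simp flip: assoc)
  have a3: "a * (e * (f * (a * b))) = a * b" for b using arg_cong[OF a(3), of "\<lambda>c. c * b"] by (simp add: assoc)
  have a2: "e * (f * (a * (e * f))) = e * f" using a(2) by (simp add: assoc)
  have "f * (a * e) = a"
  proof (rule unique[of "e * f"])
    show "e * f * (f * (a * e)) * (e * f) = e * f" by (simp add: assoc e' f' a2)
    show "f * (a * e) * (e * f) * (f * (a * e)) = f * (a * e)" by (simp add: assoc e' f' a3)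
  qed (use a T closed in auto)
  then have "a * a = (f * (a * e)) * (f * (a * e))" by simp
  also have "\<dots> = f * (a * e)" by (simp add: assoc a3)
  also have "\<dots> = a" by fact
  finally have aa: "a * a = a" .
  have "e * f = a"
    by (rule unique[of a]) (use a aa T closed in \<open>auto simp: assoc\<close>)
  then show ?thesis using aa by simp
qed

lemma concentrates_on_idempotent_class:
  fixes p :: "'a::semigroup_mult set set"
  assumes sp: "strongly_productive p" and nid: "\<not> idempotent_uf p" and wf: "idempotents_wf TYPE('a)"
    and TP: "T \<in> p" and inv: "inverse_semigroup_on T" and cong: "congruence_on T \<gamma>"
    and comm: "\<And>x y. x \<in> T \<Longrightarrow> y \<in> T \<Longrightarrow> (x * y, y * x) \<in> \<gamma>"
  obtains m where "m \<in> T" "m * m = m" "{x \<in> T. (x, m) \<in> \<gamma>} \<in> p"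
proof -
  note uf = sp_uf[OF sp]
  note refl = congruence_refl[OF cong] and sym = congruence_sym[OF cong]
    and trans [trans] = congruence_trans[OF cong]
    and left = congruence_left[OF cong] and right = congruence_right[OF cong]
  have closed: "a \<in> T \<Longrightarrow> b \<in> T \<Longrightarrow> a * b \<in> T" for a b
    using inv by (auto simp: inverse_semigroup_on_def)
  have "\<forall>x\<in>T. \<exists>y. y \<in> T \<and> x * y * x = x"
    using inv unfolding inverse_semigroup_on_def by blast
  then obtain i where i: "x \<in> T \<Longrightarrow> i x \<in> T" "x \<in> T \<Longrightarrow> x * i x * x = x" for x
    by metis
  \<comment> \<open>For idempotent \<open>e\<close> this is the preimage of the principal ideal
    generated by the class of \<open>e\<close> in the quotient.\<close>
  define below where "below e = {z \<in> T. (z * e, z) \<in> \<gamma>}" for e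
  define E where "E x = x * i x" for x
  have ET: "x \<in> T \<Longrightarrow> E x \<in> T" for x by (simp add: E_def i closed)
  have EE: "x \<in> T \<Longrightarrow> E x * E x = E x" for x
    using arg_cong[OF i(2), of x "\<lambda>y. y * i x"] by (simp add: E_def mult.assoc)
  define B where "B = {x \<in> T. below (E x) \<in> p}"
  have B: "B \<in> p"
    unfolding B_def
  proof (rule sp_ideal_dichotomy[OF sp TP nid])
    fix x assume x: "x \<in> T"
    have "(x * E x, x) \<in> \<gamma>" using comm[OF x ET[OF x]] i(2)[OF x] by (simp add: E_def)
    then show "x \<in> below (E x)" using x by (simp add: below_def)
    fix y assume y: "y \<in> T"
    have "(x * y * E x, E x * (x * y)) \<in> \<gamma>" by (intro comm closed x y ET)
    also have "E x * (x * y) = x * y" using i(2)[OF x] by (simp add: E_def flip: mult.assoc)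
    finally show "x * y \<in> below (E x)" using x y closed by (simp add: below_def)
  qed
  define A where "A = {e \<in> T. e * e = e \<and> below e \<in> p}"
  have "A \<noteq> {}" using uf_nonempty[OF uf B] ET EE by (auto simp: A_def B_def)
  moreover have "A \<subseteq> {e. e * e = e}" by (auto simp: A_def)
  ultimately obtain m where m: "m \<in> A" "\<And>a. a \<in> A \<Longrightarrow> a * m = a \<Longrightarrow> a = m"
    using wf unfolding idempotents_wf_def by meson
  have mT: "m \<in> T" and mm: "m * m = m" and mp: "below m \<in> p" using m(1) by (auto simp: A_def)
  \<comment> \<open>The product \<open>E z * m\<close> is idempotent, belongs to \<open>A\<close>
    and lies below \<open>m\<close>, so minimality of \<open>m\<close> applies.\<close>
  have Em: "E z * m = m" if z: "z \<in> B" for z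
  proof (rule m(2))
    have zT: "z \<in> T" using z by (simp add: B_def)
    have "below (E z) \<inter> below m \<subseteq> below (E z * m)"
    proof
      fix w assume w: "w \<in> below (E z) \<inter> below m"
      then have "(w * E z * m, w * m) \<in> \<gamma>" using mT by (intro right) (auto simp: below_def)
      also have "(w * m, w) \<in> \<gamma>" using w by (simp add: below_def)
      finally show "w \<in> below (E z * m)" using w by (simp add: below_def mult.assoc)
    qed
    moreover have "below (E z) \<inter> below m \<in> p" using uf_Int[OF uf _ mp] z by (simp add: B_def)
    ultimately have "below (E z * m) \<in> p" using uf_mono[OF uf] by blast
    then show "E z * m \<in> A"
      using inverse_semigroup_idempotent_mult[OF inv ET[OF zT] mT EE[OF zT] mm] closed ET[OF zT] mT
      by (simp add: A_def)
    show "E z * m * m = E z * m" by (simp add: mult.assoc mm)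
  qed
  \<comment> \<open>The preimage of the maximal subgroup of the quotient whose identity is the class
    of \<open>m\<close>.\<close>
  define V where "V = {z \<in> T. (z * m, z) \<in> \<gamma> \<and> (\<exists>y\<in>T. (z * y, m) \<in> \<gamma>)}"
  have "B \<inter> below m \<subseteq> V"
  proof
    fix z assume z: "z \<in> B \<inter> below m"
    then have zT: "z \<in> T" by (simp add: B_def)
    have "z * (i z * m) = m" using Em[of z] z by (simp add: E_def mult.assoc)
    then have "(z * (i z * m), m) \<in> \<gamma>" using refl[OF mT] by simp
    moreover have "i z * m \<in> T" using i zT mT closed by simp
    ultimately show "z \<in> V" using z zT by (auto simp: V_def below_def)
  qed
  then have V: "V \<in> p" using uf_mono[OF uf uf_Int[OF uf B mp]] by simp
  have VT: "V \<subseteq> T" by (auto simp: V_def)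
  have Vclosed: "z * w \<in> V" if z: "z \<in> V" and w: "w \<in> V" for z w
  proof -
    obtain y y' where y: "z \<in> T" "y \<in> T" "(z * y, m) \<in> \<gamma>" "(z * m, z) \<in> \<gamma>"
      and y': "w \<in> T" "y' \<in> T" "(w * y', m) \<in> \<gamma>" "(w * m, w) \<in> \<gamma>"
      using z w by (auto simp: V_def)
    have below: "(z * (w * m), z * w) \<in> \<gamma>" by (rule left[OF y'(4) y(1)])
    have "(z * ((w * y') * y), z * (m * y)) \<in> \<gamma>" by (rule left[OF right[OF y'(3) y(2)] y(1)])
    then have "((z * w) * (y' * y), (z * m) * y) \<in> \<gamma>" by (simp add: mult.assoc)
    also have "((z * m) * y, z * y) \<in> \<gamma>" by (rule right[OF y(4,2)])
    also have "(z * y, m) \<in> \<gamma>" by fact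
    finally have "((z * w) * (y' * y), m) \<in> \<gamma>" .
    moreover have "z * w \<in> T" "y' * y \<in> T" using y y' closed by auto
    ultimately show ?thesis using below unfolding V_def by (auto simp: mult.assoc)
  qed
  interpret productive_subsemigroup p V
    by unfold_locales (use sp V Vclosed nid in auto)
  have "character_kernel V \<subseteq> {x \<in> T. (x, m) \<in> \<gamma>}"
  proof
    fix x assume x: "x \<in> character_kernel V"
    then have xV: "x \<in> T" "(x * m, x) \<in> \<gamma>" by (auto simp: character_kernel_def V_def)
    obtain c where c: "c \<in> V" "(c * x, c) \<in> \<gamma>"
      using character_kernel_trivial[OF cong comm VT Vclosed x] by blast
    then obtain y where y: "c \<in> T" "y \<in> T" "(c * y, m) \<in> \<gamma>" by (auto simp: V_def)
    \<comment> \<open>The relation \<open>c * x\<close> to \<open>c\<close> is cancelled in this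
      group: \<open>m\<close> is replaced by \<open>c * y\<close>, and \<open>c\<close> absorbs
      \<open>x\<close>.\<close>
    have "(x, x * m) \<in> \<gamma>" by (rule sym[OF xV(2)])
    also have "(x * m, x * (c * y)) \<in> \<gamma>" by (rule left[OF sym[OF y(3)] xV(1)])
    also have "x * (c * y) = (x * c) * y" by (simp add: mult.assoc)
    also have "((x * c) * y, (c * x) * y) \<in> \<gamma>" by (rule right[OF comm[OF xV(1) y(1)] y(2)])
    also have "((c * x) * y, c * y) \<in> \<gamma>" by (rule right[OF c(2) y(2)])
    also have "(c * y, m) \<in> \<gamma>" by fact
    finally show "x \<in> {x \<in> T. (x, m) \<in> \<gamma>}" using xV by simp
  qed
  then have "{x \<in> T. (x, m) \<in> \<gamma>} \<in> p" by (rule uf_mono[OF uf common_kernel_in])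
  then show ?thesis using that mT mm by blast
qed

text \<open>In class 1, equality serves as the congruence and the class of \<open>m\<close> is a
  singleton. In higher classes, the class of the idempotent \<open>m\<close> lies in the preimage of
  the idempotents, which has smaller solvability class.\<close>

lemma solvable_class_idempotent:
  fixes p :: "'a::semigroup_mult set set"
  assumes sp: "strongly_productive p" and wf: "idempotents_wf TYPE('a)"
  shows "solvable_class n T \<Longrightarrow> T \<in> p \<Longrightarrow> idempotent_uf p"
proof (induction n T rule: solvable_class.induct)
  case (2 T)
  show ?case
  proof (rule ccontr)
    assume nid: "\<not> idempotent_uf p"
    have inv: "inverse_semigroup_on T" and comm: "\<And>x y. x \<in> T \<Longrightarrow> y \<in> T \<Longrightarrow> (x * y, y * x) \<in> Id_on T"
      using 2(1) by (auto simp: inverse_semigroup_on_def)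
    have cong: "congruence_on T (Id_on T)"
      using 2 by (auto simp: congruence_on_def inverse_semigroup_on_def equiv_def refl_on_def sym_def trans_def)
    obtain m where "{x \<in> T. (x, m) \<in> Id_on T} \<in> p"
      using concentrates_on_idempotent_class[OF sp nid wf 2(2) inv cong comm] by blast
    then have "{m} \<in> p" by (rule uf_mono[OF sp_uf[OF sp]]) auto
    then show False using sp_singleton[OF sp] nid by blast
  qed
next
  case (3 n T)
  then obtain \<gamma> where inv: "inverse_semigroup_on T" and cong: "congruence_on T \<gamma>"
    and comm: "\<And>x y. x \<in> T \<Longrightarrow> y \<in> T \<Longrightarrow> (x * y, y * x) \<in> \<gamma>"
    and solv: "solvable_class (Suc n) {x \<in> T. (x * x, x) \<in> \<gamma>}"
    by auto
  show ?case
  proof (rule ccontr)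
    assume nid: "\<not> idempotent_uf p"
    obtain m where m: "m \<in> T" "m * m = m" "{x \<in> T. (x, m) \<in> \<gamma>} \<in> p"
      using concentrates_on_idempotent_class[OF sp nid wf 3(3) inv cong comm] by blast
    have "(x * x, x) \<in> \<gamma>" if x: "x \<in> T" "(x, m) \<in> \<gamma>" for x
    proof -
      have "(x * x, x * m) \<in> \<gamma>" by (intro congruence_left[OF cong] x)
      moreover have "(x * m, m * m) \<in> \<gamma>" by (intro congruence_right[OF cong] x m)
      ultimately show ?thesis
        using m(2) congruence_sym[OF cong] congruence_trans[OF cong] x(2) by metis
    qed
    then have "{x \<in> T. (x * x, x) \<in> \<gamma>} \<in> p" by (intro uf_mono[OF sp_uf[OF sp] m(3)]) auto
    then show False using 3(1)[OF solv] nid by blast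
  qed
qed simp

section \<open>Commutative semigroups\<close>

text \<open>\<open>spow x n\<close> is the power with exponent \<open>n + 1\<close>.\<close>
primrec spow :: "'a::semigroup_mult \<Rightarrow> nat \<Rightarrow> 'a" where
  "spow x 0 = x"
| "spow x (Suc n) = x * spow x n"

lemma spow_add: "spow x m * spow x n = spow x (Suc (m + n))"
  by (induction m) (simp_all add: mult.assoc)

lemma spow_spow: "spow (spow x m) n = spow x (m * n + m + n)"
  by (induction n) (simp_all add: spow_add algebra_simps)

lemma spow_idempotent: "e * e = e \<Longrightarrow> spow e n = e"
  by (induction n) simp_all

lemma spow_fixed: "x * s = s \<Longrightarrow> spow x n * s = s"
  by (induction n) (simp_all add: mult.assoc)

lemma semilattice_congruence_Inter: "semilattice_congruence univ_sl_cong"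
proof -
  have eq: "equiv UNIV r" if "semilattice_congruence r" for r :: "('a \<times> 'a) set"
    using that by (simp add: semilattice_congruence_def congruence_on_def)
  have "equiv UNIV (univ_sl_cong :: ('a \<times> 'a) set)"
  proof (rule equivI)
    show "refl (univ_sl_cong :: ('a \<times> 'a) set)"
      unfolding univ_sl_cong_def refl_on_def using eq by (auto dest: equivE refl_onD elim!: equivE)
    show "sym (univ_sl_cong :: ('a \<times> 'a) set)"
      unfolding univ_sl_cong_def by (rule symI) (use eq in \<open>blast elim: equivE dest: symD\<close>)
    show "trans (univ_sl_cong :: ('a \<times> 'a) set)"
      unfolding univ_sl_cong_def by (rule transI) (use eq in \<open>blast elim: equivE dest: transD\<close>)
  qed auto
  then show ?thesis
    unfolding semilattice_congruence_def congruence_on_def univ_sl_cong_def by blast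
qed

context
  assumes commutative: "\<And>x y :: 'a::semigroup_mult. x * y = y * x"
begin

section \<open>Archimedean divisibility\<close>

lemma left_commutative: "x * (y * z) = y * (x * z :: 'a)"
  by (metis commutative mult.assoc)

lemmas mult_ac' = mult.assoc commutative left_commutative

lemma spow_mult: "spow (x * y) n = spow x n * spow (y :: 'a) n"
proof (induction n)
  case (Suc n)
  have "x * y * (spow x n * spow y n) = (x * spow x n) * (y * spow y n)"
    by (metis left_commutative mult.assoc)
  then show ?case by (simp add: Suc)
qed simp

text \<open>Made symmetric, this is the relation whose classes are the archimedean components. The
  cofactor \<open>u\<close> is always present, so \<open>x\<close> divides its own power
  \<open>x * x\<close>.\<close>

definition divides_power :: "'a \<Rightarrow> 'a \<Rightarrow> bool" where
  "divides_power x y \<longleftrightarrow> (\<exists>n u. spow y n = x * u)"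

lemma divides_power_trans:
  assumes "divides_power x y" "divides_power y z"
  shows "divides_power x z"
proof -
  obtain n u m v where "spow y n = x * u" "spow z m = y * v"
    using assms by (auto simp: divides_power_def)
  then have "spow z (m * n + m + n) = x * (u * spow v n)"
    by (simp add: spow_mult mult.assoc flip: spow_spow)
  then show ?thesis unfolding divides_power_def by blast
qed

lemma divides_power_mult:
  assumes "divides_power x y"
  shows "divides_power (z * x) (z * y)"
proof -
  obtain n u where "spow y n = x * u" using assms by (auto simp: divides_power_def)
  \<comment> \<open>The extra factor of the power provides the \<open>z\<close> that accompanies
    \<open>x\<close>.\<close>
  then have "spow (z * y) (Suc n) = z * y * (spow z n * (x * u))" by (simp add: spow_mult)
  also have "\<dots> = z * x * (y * (spow z n * u))" by (metis left_commutative mult.assoc)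
  finally show ?thesis unfolding divides_power_def by blast
qed

text \<open>Mutual divisibility of powers is a semilattice congruence, hence contains the least
  one.\<close>

lemma univ_sl_cong_archimedean:
  assumes "(x, y) \<in> (univ_sl_cong :: ('a \<times> 'a) set)"
  shows "divides_power x y"
proof -
  let ?r = "{(x, y). divides_power x y \<and> divides_power y (x :: 'a)}"
  have self: "divides_power x x" for x :: 'a
    unfolding divides_power_def by (metis spow.simps)
  have square: "divides_power x (x * x)" "divides_power (x * x) x" for x :: 'a
  proof -
    show "divides_power x (x * x)" unfolding divides_power_def by (metis spow.simps(1))
    have "spow x 2 = x * x * x" by (simp add: numeral_2_eq_2 mult.assoc)
    then show "divides_power (x * x) x" unfolding divides_power_def by blast
  qed
  have "equiv UNIV ?r"
    by (rule equivI) (auto simp: refl_on_def sym_def trans_def self intro: divides_power_trans)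
  moreover have "(z * x, z * y) \<in> ?r \<and> (x * z, y * z) \<in> ?r" if "(x, y) \<in> ?r" for x y z
    using that divides_power_mult commutative[of _ z] by simp
  ultimately have "congruence_on UNIV ?r" unfolding congruence_on_def by blast
  moreover have "(x * y, y * x) \<in> ?r" for x y by (simp add: self commutative[of x y])
  ultimately have "semilattice_congruence ?r"
    unfolding semilattice_congruence_def using square by blast
  then show ?thesis using assms unfolding univ_sl_cong_def by blast
qed

lemma commutative_idempotent:
  fixes p :: "'a set set"
  assumes sp: "strongly_productive p" and wf: "univ_semilattice_wf TYPE('a)"
  shows "idempotent_uf p"
proof (rule ccontr)
  assume nid: "\<not> idempotent_uf p"
  note uf = sp_uf[OF sp]
  let ?N = "univ_sl_cong :: ('a \<times> 'a) set"
  have slc: "semilattice_congruence ?N" by (rule semilattice_congruence_Inter)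
  then have cong: "congruence_on UNIV ?N" and sq: "(x * x, x) \<in> ?N" for x
    by (auto simp: semilattice_congruence_def)
  note refl = congruence_refl[OF cong UNIV_I] and sym = congruence_sym[OF cong]
    and trans [trans] = congruence_trans[OF cong]
    and left = congruence_left[OF cong _ UNIV_I] and right = congruence_right[OF cong _ UNIV_I]
  define below where "below y = {z. (z * y, z) \<in> ?N}" for y
  define B where "B = {x \<in> UNIV. below x \<in> p}"
  have "UNIV \<in> p" using uf by (simp add: ultrafilter_def)
  then have B: "B \<in> p"
    unfolding B_def
  proof (rule sp_ideal_dichotomy[OF sp _ nid])
    fix x y :: 'a
    show "x \<in> below x" by (simp add: below_def sq)
    show "x * y \<in> below x"
      using right[OF sq, of x y] by (simp add: below_def mult_ac')
  qed
  define X where "X = {C \<in> UNIV // ?N. \<exists>y\<in>C. below y \<in> p}"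
  have inX: "?N `` {z} \<in> X" if "z \<in> B" for z
    using that refl[of z] by (auto simp: X_def B_def quotient_def)
  have "X \<noteq> {}" using uf_nonempty[OF uf B] inX by blast
  moreover have "X \<subseteq> UNIV // ?N" by (auto simp: X_def)
  ultimately obtain M where M: "M \<in> X"
    and least: "\<And>C. C \<in> X \<Longrightarrow> \<exists>x\<in>C. \<exists>y\<in>M. (x * y, x) \<in> ?N \<Longrightarrow> C = M"
    using wf unfolding univ_semilattice_wf_def by meson
  obtain m where m: "m \<in> M" "below m \<in> p" using M by (auto simp: X_def)
  define T where "T = {z. (z, m) \<in> ?N}"
  \<comment> \<open>The class of such a \<open>z\<close> belongs to \<open>X\<close> and lies below
    the minimal class \<open>M\<close>, so it equals \<open>M\<close>.\<close>
  have "B \<inter> below m \<subseteq> T"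
  proof
    fix z assume z: "z \<in> B \<inter> below m"
    then have "?N `` {z} = M"
      using least[OF inX[of z]] m(1) refl[of z] by (auto simp: below_def)
    then show "z \<in> T" using m(1) by (auto simp: T_def)
  qed
  then have T: "T \<in> p" using uf_mono[OF uf uf_Int[OF uf B m(2)]] by simp
  have Tclosed: "z * w \<in> T" if "z \<in> T" "w \<in> T" for z w
  proof -
    have "(z * w, m * w) \<in> ?N" using that by (intro right) (simp add: T_def)
    also have "(m * w, m * m) \<in> ?N" using that by (intro left) (simp add: T_def)
    also have "(m * m, m) \<in> ?N" by (rule sq)
    finally show ?thesis by (simp add: T_def)
  qed
  have arch: "\<exists>n u. spow y n = x * u" if "x \<in> T" "y \<in> T" for x y
  proof -
    have "(x, m) \<in> ?N" "(y, m) \<in> ?N" using that by (simp_all add: T_def)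
    then have "(x, y) \<in> ?N" by (rule trans[OF _ sym])
    then show ?thesis using univ_sl_cong_archimedean by (simp add: divides_power_def)
  qed
  have spowT: "spow x n \<in> T" if "x \<in> T" for x n
    by (induction n) (use that Tclosed in auto)
  interpret productive_subsemigroup p T
    by unfold_locales (use sp T Tclosed nid in auto)
  let ?K = "character_kernel T"
  have K: "\<exists>c\<in>T. c * x = c" if "x \<in> ?K" for x
  proof -
    have "congruence_on UNIV (Id :: ('a \<times> 'a) set)"
      by (auto simp: congruence_on_def equiv_def refl_on_def sym_def trans_def)
    from character_kernel_trivial[OF this _ _ Tclosed that] commutative show ?thesis by auto
  qed
  have KT: "?K \<subseteq> T" by (auto simp: character_kernel_def)
  \<comment> \<open>By the archimedean property an idempotent \<open>e\<close> is a multiple of the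
    element \<open>c\<close> fixed by \<open>x\<close>, so \<open>e\<close> is fixed as
    well.\<close>
  have zero: "e * x = e" if e: "e \<in> T" "e * e = e" and x: "x \<in> ?K" for e x
  proof -
    obtain c where c: "c \<in> T" "c * x = c" using K[OF x] by blast
    obtain n v where "spow e n = c * v" using arch[OF c(1) e(1)] by blast
    then have "e = v * c" using spow_idempotent[OF e(2)] commutative by simp
    then show ?thesis using c(2) by (simp add: mult.assoc)
  qed
  let ?B = "{x \<in> ?K. x * x \<noteq> x}"
  \<comment> \<open>Any two idempotents of the kernel absorb each other and coincide, so otherwise
    \<open>p\<close> would be principal.\<close>
  have "?B \<in> p"
  proof (rule ccontr)
    assume "?B \<notin> p"
    then have idem: "?K - ?B \<in> p" by (rule uf_Diff[OF uf common_kernel_in])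
    then obtain e where e: "e \<in> ?K - ?B" using uf_nonempty[OF uf] by blast
    have "?K - ?B \<subseteq> {e}"
    proof
      fix f assume f: "f \<in> ?K - ?B"
      have "e * f = e" "f * e = f" using e f KT by (auto intro!: zero)
      then show "f \<in> {e}" using commutative by auto
    qed
    then have "{e} \<in> p" by (rule uf_mono[OF uf idem])
    then show False using sp_singleton[OF sp] nid by blast
  qed
  moreover have "?B \<notin> p"
  proof (rule criterion, rule notI)
    fix x :: "nat \<Rightarrow> 'a" and i
    assume x: "FP x \<subseteq> ?B" and "FP_min x i \<in> p"
    then obtain y where y: "FP y \<subseteq> FP_min x i" using sp_FP[OF sp] by blast
    define c where "c = x i"
    have c: "c \<in> ?K" "c \<in> T" using x term_in_FP[of x i] KT by (auto simp: c_def)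
    obtain c' where c': "c' \<in> T" "c' * c = c'" using K[OF c(1)] by blast
    \<comment> \<open>Since \<open>c'\<close> absorbs \<open>c\<close>, so does this power of
      \<open>c\<close>; it therefore absorbs all powers of \<open>c\<close> and is
      idempotent.\<close>
    obtain n u where n: "spow c n = c' * u" using arch[OF c'(1) c(2)] by blast
    define e where "e = spow c n"
    have "c * e = e" using c'(2) by (metis commutative e_def mult.assoc n)
    then have ee: "e * e = e" using spow_fixed[of c e n] by (simp add: e_def)
    have eT: "e \<in> T" using c spowT by (simp add: e_def)
    have yi: "y j = c \<or> (\<exists>d. y j = c * d)" for j
      using y term_in_FP[of y j] by (auto simp: c_def elim: FP_min_cases)
    have pow: "fprod y {..k} = spow c k \<or> (\<exists>d. fprod y {..k} = spow c k * d)" for k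
    proof (induction k)
      case 0
      have "{..0::nat} = {0}" by auto
      then show ?case using yi[of 0] by simp
    next
      case (Suc k)
      have "{..Suc k} = {..k} \<union> {Suc k}" by auto
      moreover have "fprod y ({..k} \<union> {Suc k}) = fprod y {..k} * fprod y {Suc k}"
        by (rule fprod_Un) auto
      ultimately have eq: "fprod y {..Suc k} = y (Suc k) * fprod y {..k}"
        using commutative by simp
      have "spow c (Suc k) * d = c * (spow c k * d)" "c * d * spow c k = spow c (Suc k) * d"
        "c * d * (spow c k * d') = spow c (Suc k) * (d * d')" for d d'
        by (simp_all add: mult_ac')
      then show ?case unfolding eq using Suc yi[of "Suc k"] by (metis spow.simps(2))
    qed
    \<comment> \<open>All terms of \<open>y\<close> are multiples of \<open>c\<close>, so
      \<open>n + 1\<close> of them multiply to a multiple of \<open>spow c n\<close>, that is, of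
      \<open>e\<close>. As \<open>e\<close> absorbs the kernel, \<open>w\<close> equals
      \<open>e\<close>, although \<open>FP x\<close> contains no idempotents.\<close>
    define w where "w = fprod y {..n}"
    have "w \<in> FP y" unfolding w_def by (rule fprod_in_FP) auto
    then have "w \<in> FP x" using y by (auto simp: FP_min_def FP_def)
    then have w: "w \<in> ?K" "w * w \<noteq> w" using x by auto
    have "e * w = w" using pow[of n] ee unfolding w_def[symmetric] e_def[symmetric]
      by (auto simp flip: mult.assoc)
    then have "w = e" using zero[OF eT ee w(1)] by simp
    then show False using w(2) ee by simp
  qed
  ultimately show False by blast
qed

end

theorem mainTheorem1:
  fixes p :: "'a::semigroup_mult set set"
  assumes "((\<forall>x y :: 'a. x * y = y * x) \<and> univ_semilattice_wf TYPE('a))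
         \<or> (solvable_inverse (UNIV :: 'a set) \<and> idempotents_wf TYPE('a))"
    and "strongly_productive p"
  shows "idempotent_uf p"
  using assms(1)
proof
  assume "(\<forall>x y :: 'a. x * y = y * x) \<and> univ_semilattice_wf TYPE('a)"
  then have comm: "\<And>x y :: 'a. x * y = y * x" and wf: "univ_semilattice_wf TYPE('a)" by auto
  from commutative_idempotent[OF comm assms(2) wf] show ?thesis .
next
  assume *: "solvable_inverse (UNIV :: 'a set) \<and> idempotents_wf TYPE('a)"
  then obtain n where "solvable_class n (UNIV :: 'a set)" by (auto simp: solvable_inverse_def)
  moreover have "UNIV \<in> p" using sp_uf[OF assms(2)] by (simp add: ultrafilter_def)
  ultimately show ?thesis using * by (intro solvable_class_idempotent[OF assms(2)]) auto
qed

end
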